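(* For any integer $r\ge1$ and any $\eta>0$: (a) for stochastic submodular cover there is a set-based $r$-round adaptive solution with expected cost at most $O\!\left(\frac{r}{\eta}Q^{1/r}\log Q\right)\cdot\mathrm{OPT}$ that covers $f$ with probability at least $1-\eta$; (b) for scenario submodular cover with $s$ scenarios there is a set-based $r$-round adaptive solution with expected cost at most $O\!\left(\frac{r}{\eta}\,s^{1/r}(\log s+r\log Q)\right)\cdot\mathrm{OPT}$ that covers $f$ with probability at least $1-\eta$. Here $\mathrm{OPT}$ is the expected cost of an optimal fully adaptive solution (which covers $f$ with probability one).
   Context: Common setting: finite ground set $U$, monotone submodular $f:2^U\to\mathbb{Z}_{\ge 0}$, $Q:=f(U)$, items $\mathbf{X}_1,\dots,\mathbf{X}_m$ with costs $c_i>0$, each realizing to an element of $U$; probing $\mathbf{X}_i$ costs $c_i$ and reveals its realization; the realized set $S$ covers $f$ if $f(S)=Q$, and the realizations of all items always cover $f$. Stochastic submodular cover: items are mutually independent with known distributions. Scenario submodular cover: the joint distribution is given explicitly by $s$ scenarios, scenario $\omega$ having probability $p_\omega>0$ and fixing the realization $X_i(\omega)$ of every item. A fully adaptive solution chooses each next item based on all realizations observed so far and must cover $f$ with probability one. A set-based $r$-round adaptive solution: in each round $i=1,\dots,r$ it selects a subset $\mathbf{S}_i$ of items (depending on the realizations observed in rounds $1,\dots,i-1$) which are all probed in parallel, incurring cost $\sum_{\mathbf{X}_j\in\mathbf{S}_i}c_j$; its cost is the expected total cost over all rounds.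
   Formalization: log Q and log s in the bounds are read as 1 + ln Q and 1 + ln s, since for Q = 1 in (a), and Q = s = 1 in (b), the literal bound would be 0·OPT, which is false; for Q ≥ 2 the bounds agree up to a constant factor. *)

theory Defs
  imports "HOL-Probability.Probability"
begin

definition monotone_submodular :: "'a set \<Rightarrow> ('a set \<Rightarrow> nat) \<Rightarrow> bool" where
  "monotone_submodular U f \<longleftrightarrow>
     (\<forall>A B. A \<subseteq> B \<and> B \<subseteq> U \<longrightarrow> f A \<le> f B) \<and>
     (\<forall>A B. A \<subseteq> U \<and> B \<subseteq> U \<longrightarrow> f (A \<union> B) + f (A \<inter> B) \<le> f A + f B)"

text \<open>Items are indexed 0..<m; a realization is a function omega : nat => 'a giving the
  outcome of every item.  An observation is a partial map from probed items to outcomes.\<close>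
type_synonym 'a obs = "nat \<Rightarrow> 'a option"

definition observe :: "(nat \<Rightarrow> 'a) \<Rightarrow> nat set \<Rightarrow> 'a obs" where
  "observe \<omega> S = (\<lambda>i. if i \<in> S then Some (\<omega> i) else None)"

text \<open>Fully adaptive policy: given the observations so far, choose the next item to probe
  (None = stop).  Choosing an invalid or already probed item is treated as stopping.
  Every real step probes a new item of 0..<m, so m steps suffice.\<close>
definition adapt_step :: "nat \<Rightarrow> ('a obs \<Rightarrow> nat option) \<Rightarrow> (nat \<Rightarrow> 'a) \<Rightarrow> 'a obs \<Rightarrow> 'a obs" where
  "adapt_step m \<pi> \<omega> ob = (case \<pi> ob of None \<Rightarrow> ob
      | Some i \<Rightarrow> (if i < m \<and> ob i = None then ob(i \<mapsto> \<omega> i) else ob))"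

definition adapt_final :: "nat \<Rightarrow> ('a obs \<Rightarrow> nat option) \<Rightarrow> (nat \<Rightarrow> 'a) \<Rightarrow> 'a obs" where
  "adapt_final m \<pi> \<omega> = (adapt_step m \<pi> \<omega> ^^ m) Map.empty"

definition OPT :: "nat \<Rightarrow> (nat \<Rightarrow> real) \<Rightarrow> 'a set \<Rightarrow> ('a set \<Rightarrow> nat) \<Rightarrow> (nat \<Rightarrow> 'a) pmf \<Rightarrow> real" where
  "OPT m c U f D = Inf {measure_pmf.expectation D (\<lambda>\<omega>. sum c (dom (adapt_final m \<pi> \<omega>))) | \<pi>.
       \<forall>\<omega>\<in>set_pmf D. f (\<omega> ` dom (adapt_final m \<pi> \<omega>)) = f U}"

text \<open>Set-based round-adaptive policy: sigma k ob is the set of items probed (in parallel) in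
  round k (0-based), given the observations ob from the earlier rounds.\<close>
primrec round_obs :: "(nat \<Rightarrow> 'a obs \<Rightarrow> nat set) \<Rightarrow> (nat \<Rightarrow> 'a) \<Rightarrow> nat \<Rightarrow> 'a obs" where
  "round_obs \<sigma> \<omega> 0 = Map.empty"
| "round_obs \<sigma> \<omega> (Suc k) = round_obs \<sigma> \<omega> k ++ observe \<omega> (\<sigma> k (round_obs \<sigma> \<omega> k))"

definition rounds_cost :: "(nat \<Rightarrow> real) \<Rightarrow> nat \<Rightarrow> (nat \<Rightarrow> 'a obs \<Rightarrow> nat set) \<Rightarrow> (nat \<Rightarrow> 'a) \<Rightarrow> real" where
  "rounds_cost c r \<sigma> \<omega> = (\<Sum>k<r. sum c (\<sigma> k (round_obs \<sigma> \<omega> k)))"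

definition set_based_policy :: "nat \<Rightarrow> (nat \<Rightarrow> 'a obs \<Rightarrow> nat set) \<Rightarrow> bool" where
  "set_based_policy m \<sigma> \<longleftrightarrow> (\<forall>k ob. \<sigma> k ob \<subseteq> {..<m})"

definition rounds_cover_prob :: "'a set \<Rightarrow> ('a set \<Rightarrow> nat) \<Rightarrow> nat \<Rightarrow> (nat \<Rightarrow> 'a obs \<Rightarrow> nat set) \<Rightarrow> (nat \<Rightarrow> 'a) pmf \<Rightarrow> real" where
  "rounds_cover_prob U f r \<sigma> D =
     measure_pmf.prob D {\<omega>. f (\<omega> ` dom (round_obs \<sigma> \<omega> r)) = f U}"

definition cover_instance :: "'a set \<Rightarrow> ('a set \<Rightarrow> nat) \<Rightarrow> nat \<Rightarrow> (nat \<Rightarrow> real) \<Rightarrow> (nat \<Rightarrow> 'a) pmf \<Rightarrow> bool" where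
  "cover_instance U f m c D \<longleftrightarrow> finite U \<and> monotone_submodular U f \<and> (\<forall>i<m. c i > 0) \<and>
     (\<forall>\<omega>\<in>set_pmf D. (\<forall>i<m. \<omega> i \<in> U) \<and> f (\<omega> ` {..<m}) = f U)"

end

theory Submission
  imports Defs
begin

text \<open>
  Fix an optimal adaptive policy. In each round, while the unfinished probability is \<open>p\<close>, run the
  policy on an independent copy of the realization that is unfinished as well; a potential
  argument shows that the items it probes, which cost at most \<open>OPT\<close> in expectation, raise the
  expected potential by at least of the order of \<open>\<delta> p\<^sup>2\<close>. Hence halving the unfinished probability
  from \<open>q\<close> costs at most of the order of \<open>L OPT / (\<delta> q)\<close>, where \<open>L\<close> bounds the potential, and
  these costs form a geometric series. In the independent case a round is finished once the
  deficit of \<open>f\<close> has shrunk by the factor \<open>\<delta>\<close>, and the potential is the logarithm of the deficit;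
  in the scenario case it is finished once \<open>f\<close> is covered or the number of consistent
  realizations has shrunk by \<open>\<delta>\<close>, and the potential also contains the logarithm of that number.
  With \<open>\<delta> = (2 Q) powr (- 1 / r)\<close>, respectively \<open>(2 s) powr (- 1 / r)\<close>, \<open>r\<close> rounds of failure
  probability \<open>\<eta> / r\<close> suffice.
\<close>

subsection \<open>Monotone submodular functions\<close>

text \<open>A round must fix its items before it sees any outcome, so it cannot follow the adaptive
  policy; a run on an independent copy chooses items without looking at the true realization.
  Halving is better than one maximization aimed at the final unfinished mass: with a gain per unit
  cost of order \<open>p^2\<close>, going down to mass \<open>\<eta>\<close> at once could cost
  order \<open>L / \<eta>^2\<close>, whereas in halving from \<open>q\<close> only mass
  \<open>q\<close> can still gain potential, so the cost is of order \<open>q * L / q^2\<close>. The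
  failure probability \<open>\<eta> / r\<close> per round accounts for the factor \<open>r\<close>
  in the bounds; the logarithm of the full range is paid only once, because
  \<open>ln (1 / \<delta>)\<close> is its \<open>r\<close>-th part. Probabilities are kept as
  unnormalized weights, so conditioning on an observation is just restriction to a subset.\<close>

lemma finite_argmax:
  fixes g :: "'b \<Rightarrow> real"
  assumes "finite S" "S \<noteq> {}"
  obtains x where "x \<in> S" "\<And>y. y \<in> S \<Longrightarrow> g y \<le> g x"
proof -
  have "Max (g ` S) \<in> g ` S" using assms by simp
  then obtain x where "x \<in> S" "g x = Max (g ` S)" by auto
  with assms show thesis using that[of x] by simp
qed

lemma monotone_submodular_mono:
  "monotone_submodular U f \<Longrightarrow> A \<subseteq> B \<Longrightarrow> B \<subseteq> U \<Longrightarrow> f A \<le> f B"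
  by (auto simp: monotone_submodular_def)

lemma monotone_submodular_marginal:
  assumes "monotone_submodular U f" "A \<subseteq> B" "B \<subseteq> U" "C \<subseteq> U"
  shows "real (f (B \<union> C)) - real (f B) \<le> real (f (A \<union> C)) - real (f A)"
proof -
  have "A \<union> C \<subseteq> U" using assms by auto
  then have "f ((A \<union> C) \<union> B) + f ((A \<union> C) \<inter> B) \<le> f (A \<union> C) + f B"
    using assms by (auto simp: monotone_submodular_def)
  moreover have "(A \<union> C) \<union> B = B \<union> C" using assms by auto
  moreover have "f A \<le> f ((A \<union> C) \<inter> B)"
    using assms by (intro monotone_submodular_mono[OF assms(1)]) auto
  ultimately have "f (B \<union> C) + f A \<le> f (A \<union> C) + f B" by simp
  then show ?thesis by linarith
qed

lemma monotone_submodular_sum_marginals: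
  assumes ms: "monotone_submodular U f" and "finite E" "S \<subseteq> U" "x ` E \<subseteq> U"
  shows "real (f (S \<union> x ` E)) - real (f S) \<le> (\<Sum>e\<in>E. real (f (insert (x e) S)) - real (f S))"
  using assms(2,4)
proof (induction E rule: finite_induct)
  case (insert e E)
  have "real (f ((S \<union> x ` E) \<union> {x e})) - real (f (S \<union> x ` E)) \<le> real (f (S \<union> {x e})) - real (f S)"
    using insert.prems assms(3) by (intro monotone_submodular_marginal[OF ms]) auto
  with insert show ?case by simp
qed simp

text \<open>Here \<open>S x\<close> is what a realization \<open>x\<close> shows so far and \<open>E x\<close> is what the adaptive policy
  adds to it. If the sets \<open>E x\<close> were mostly useless for the other \<open>S y\<close>, then joining many
  of them would push \<open>f\<close> beyond \<open>T\<close>; this is expressed through a set \<open>F\<close> maximizing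
  \<open>f F - \<lambda> h F\<close>.\<close>
lemma independent_copy_gain:
  assumes ms: "monotone_submodular U f" and fin: "finite U" "finite X"
    and w: "\<And>x. x \<in> X \<Longrightarrow> w x \<ge> 0"
    and SU: "\<And>x. x \<in> X \<Longrightarrow> S x \<subseteq> U" and EU: "\<And>x. x \<in> X \<Longrightarrow> E x \<subseteq> U"
    and cov: "\<And>x. x \<in> X \<Longrightarrow> f (S x \<union> E x) = f U"
    and tau: "0 < \<tau>" "\<And>x. x \<in> X \<Longrightarrow> \<tau> \<le> real (f U) - real (f (S x))"
    and R: "R \<subseteq> U" "\<And>x. x \<in> X \<Longrightarrow> R \<subseteq> S x" and T: "0 < T" "real (f U) - real (f R) \<le> T"
  shows "\<tau> / (4 * T) * (\<Sum>x\<in>X. w x)\<^sup>2 \<le>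
    (\<Sum>x\<in>X. \<Sum>y\<in>X. w x * w y * ((real (f (S y \<union> E x)) - real (f (S y))) / (real (f U) - real (f (S y)))))"
    (is "_ \<le> ?a")
proof -
  define p where "p = (\<Sum>x\<in>X. w x)"
  define d where "d = (\<lambda>x. real (f U) - real (f (S x)))"
  define g where "g = (\<lambda>F x. (real (f (S x \<union> F)) - real (f (S x))) / d x)"
  define h where "h = (\<lambda>F. \<Sum>x\<in>X. w x * g F x)"
  have d: "d x > 0" "d x \<ge> \<tau>" if "x \<in> X" for x using tau(1) tau(2)[OF that] by (auto simp: d_def)
  have a: "?a = (\<Sum>x\<in>X. \<Sum>y\<in>X. w x * w y * g (E x) y)" by (simp add: g_def d_def)
  have "p \<ge> 0" using w by (auto simp: p_def intro: sum_nonneg)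
  show ?thesis
  proof (cases "p = 0")
    case True
    have "g (E x) y \<ge> 0" if "x \<in> X" "y \<in> X" for x y
      using monotone_submodular_mono[OF ms, of "S y" "S y \<union> E x"] SU[OF that(2)] EU[OF that(1)] d[OF that(2)]
      by (auto simp: g_def)
    then have "?a \<ge> 0" unfolding a using w by (intro sum_nonneg mult_nonneg_nonneg) auto
    then show ?thesis using True by (simp add: p_def)
  next
    case False
    with \<open>p \<ge> 0\<close> have p: "p > 0" by simp
    \<comment> \<open>With this penalty, maximality of \<open>F\<close> against \<open>R\<close>,
      where \<open>h\<close> vanishes, gives \<open>h F \<le> p / 2\<close>: on average
      \<open>F\<close> closes at most half of a deficit.\<close>
    define l where "l = 2 * T / p"
    have l: "l > 0" using p T by (simp add: l_def)
    define \<F> where "\<F> = {F. R \<subseteq> F \<and> F \<subseteq> U}"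
    have "finite \<F>" using fin(1) by (auto simp: \<F>_def intro: finite_subset[of _ "Pow U"])
    moreover have "R \<in> \<F>" using R by (simp add: \<F>_def)
    ultimately obtain F where F: "F \<in> \<F>" "\<And>F'. F' \<in> \<F> \<Longrightarrow> real (f F') - l * h F' \<le> real (f F) - l * h F"
      using finite_argmax[of \<F> "\<lambda>F. real (f F) - l * h F"] by blast
    have FU: "F \<subseteq> U" "R \<subseteq> F" using F(1) by (auto simp: \<F>_def)
    have "h R = 0"
      unfolding h_def by (intro sum.neutral) (auto simp: g_def Un_absorb2 R)
    then have "l * h F \<le> real (f F) - real (f R)" using F(2)[OF \<open>R \<in> \<F>\<close>] by simp
    also have "\<dots> \<le> T" using T(2) monotone_submodular_mono[OF ms FU(1)] by simp
    finally have hF: "h F \<le> p / 2" using p T by (simp add: l_def field_simps)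
    \<comment> \<open>\<open>E x\<close> must close whatever \<open>F\<close> leaves of the deficit
      of \<open>S x\<close>. Submodularity moves that gain to the smaller base \<open>F\<close>,
      where maximality bounds it by \<open>l\<close> times the gain in \<open>h\<close>.\<close>
    have key: "\<tau> * (1 - g F x) \<le> l * (\<Sum>y\<in>X. w y * g (E x) y)" if x: "x \<in> X" for x
    proof -
      have "f (S x \<union> F \<union> E x) = f U"
        using monotone_submodular_mono[OF ms, of "S x \<union> E x" "S x \<union> F \<union> E x"]
          monotone_submodular_mono[OF ms, of "S x \<union> F \<union> E x" U] SU[OF x] EU[OF x] FU cov[OF x] by fastforce
      then have 1: "real (f U) - real (f (S x \<union> F)) \<le> real (f (F \<union> E x)) - real (f F)"
        using monotone_submodular_marginal[OF ms, of F "S x \<union> F" "E x"] SU[OF x] EU[OF x] FU by auto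
      have "f (S x \<union> F) \<le> f U" using SU[OF x] FU by (intro monotone_submodular_mono[OF ms]) auto
      then have "g F x \<le> 1" using d[OF x] by (simp add: g_def d_def)
      then have "\<tau> * (1 - g F x) \<le> d x * (1 - g F x)" using d[OF x] by (intro mult_right_mono) auto
      also have "\<dots> = real (f U) - real (f (S x \<union> F))" using d[OF x] by (simp add: g_def field_simps d_def)
      also note 1
      also have "real (f (F \<union> E x)) - real (f F) \<le> l * (h (F \<union> E x) - h F)"
        using F(2)[of "F \<union> E x"] FU EU[OF x] by (auto simp: \<F>_def algebra_simps)
      also have "h (F \<union> E x) - h F \<le> (\<Sum>y\<in>X. w y * g (E x) y)"
      proof -
        have "g (F \<union> E x) y - g F y \<le> g (E x) y" if y: "y \<in> X" for y
        proof -
          have "real (f (S y \<union> F \<union> E x)) - real (f (S y \<union> F)) \<le> real (f (S y \<union> E x)) - real (f (S y))"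
            using SU[OF y] EU[OF x] FU by (intro monotone_submodular_marginal[OF ms]) auto
          then show ?thesis using d(1)[OF y]
            by (simp add: g_def diff_divide_distrib[symmetric] divide_right_mono Un_assoc)
        qed
        then have "w y * (g (F \<union> E x) y - g F y) \<le> w y * g (E x) y" if "y \<in> X" for y
          using w[OF that] that by (intro mult_left_mono) auto
        then have "(\<Sum>y\<in>X. w y * (g (F \<union> E x) y - g F y)) \<le> (\<Sum>y\<in>X. w y * g (E x) y)"
          by (intro sum_mono)
        then show ?thesis by (simp add: h_def sum_subtractf algebra_simps)
      qed
      finally show ?thesis using l by simp
    qed
    have "\<tau> * (p / 2) \<le> \<tau> * (p - h F)" using hF tau by simp
    also have "\<dots> = (\<Sum>x\<in>X. w x * (\<tau> * (1 - g F x)))"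
      by (simp add: p_def h_def sum_subtractf sum_distrib_left algebra_simps)
    also have "\<dots> \<le> (\<Sum>x\<in>X. w x * (l * (\<Sum>y\<in>X. w y * g (E x) y)))"
      using w key by (intro sum_mono mult_left_mono) auto
    also have "\<dots> = l * ?a" unfolding a by (simp add: sum_distrib_left mult_ac)
    finally have "\<tau> * (p / 2) \<le> 2 * T / p * ?a" by (simp add: l_def)
    then show ?thesis using p T by (simp add: p_def[symmetric] field_simps power2_eq_square)
  qed
qed

subsection \<open>A single round\<close>

text \<open>What the independent and the scenario case share. In \<open>ghost\<close>,
  \<open>x\<close> is the copy that the policy runs on and \<open>y\<close> the true realization,
  both unfinished, which is why the mass is squared; items are added to \<open>B\<close> one at a
  time, since only single-item gains can be compared with single-item costs.
  \<open>Phi_finished\<close> confines all later gain to unfinished mass.\<close>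

locale probing_round =
  fixes \<Omega> :: "'b set" and w :: "'b \<Rightarrow> real" and I :: "nat set" and c :: "nat \<Rightarrow> real"
    and probes :: "'b \<Rightarrow> nat set" and \<Phi> :: "nat set \<Rightarrow> 'b \<Rightarrow> real" and unf :: "nat set \<Rightarrow> 'b \<Rightarrow> bool"
    and L \<kappa> :: real and A0 :: "nat set"
  assumes finite: "finite \<Omega>" "finite I" and w_nonneg: "\<And>x. x \<in> \<Omega> \<Longrightarrow> w x \<ge> 0"
    and c_pos: "\<And>i. i \<in> I \<Longrightarrow> c i > 0" and probes: "\<And>x. x \<in> \<Omega> \<Longrightarrow> probes x \<subseteq> I"
    and A0: "A0 \<subseteq> I" and kappa: "\<kappa> > 0"
    and Phi_bounds: "\<And>B x. A0 \<subseteq> B \<Longrightarrow> B \<subseteq> I \<Longrightarrow> x \<in> \<Omega> \<Longrightarrow> 0 \<le> \<Phi> B x \<and> \<Phi> B x \<le> L"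
    and Phi_step: "\<And>B e x. A0 \<subseteq> B \<Longrightarrow> B \<subseteq> I \<Longrightarrow> e \<in> I \<Longrightarrow> x \<in> \<Omega> \<Longrightarrow> \<Phi> B x \<le> \<Phi> (insert e B) x"
    and Phi_finished: "\<And>A B x. A0 \<subseteq> A \<Longrightarrow> A \<subseteq> B \<Longrightarrow> B \<subseteq> I \<Longrightarrow> x \<in> \<Omega> \<Longrightarrow> \<not> unf A x \<Longrightarrow> \<Phi> B x = \<Phi> A x"
    and ghost: "\<And>B. A0 \<subseteq> B \<Longrightarrow> B \<subseteq> I \<Longrightarrow> \<kappa> * (\<Sum>x | x \<in> \<Omega> \<and> unf B x. w x)\<^sup>2 \<le>
      (\<Sum>x | x \<in> \<Omega> \<and> unf B x. \<Sum>y | y \<in> \<Omega> \<and> unf B y.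
         w x * w y * (\<Sum>e\<in>probes x - B. \<Phi> (insert e B) y - \<Phi> B y))"
begin

abbreviation unf_mass :: "nat set \<Rightarrow> real" where
  "unf_mass B \<equiv> (\<Sum>x | x \<in> \<Omega> \<and> unf B x. w x)"

abbreviation path_cost :: real where
  "path_cost \<equiv> (\<Sum>x\<in>\<Omega>. w x * sum c (probes x))"

lemma sum_path_nonneg: "x \<in> \<Omega> \<Longrightarrow> sum c (probes x) \<ge> 0"
  by (rule sum_nonneg) (meson c_pos probes less_imp_le subsetD)

lemma path_cost_nonneg: "path_cost \<ge> 0"
  by (rule sum_nonneg) (simp add: w_nonneg sum_path_nonneg)

text \<open>At a maximizer of expected potential minus \<open>\<rho>\<close> times cost no item has potential gain per
  unit cost above \<open>\<rho>\<close>, whereas by \<open>ghost\<close> the items probed by the policy would provide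
  such a gain if too much mass were unfinished.\<close>
lemma halve_unfinished:
  assumes A: "A0 \<subseteq> A" "A \<subseteq> I" and q: "unf_mass A \<le> q" "q > 0"
  obtains B where "A \<subseteq> B" "B \<subseteq> I" "unf_mass B \<le> q / 2" "\<kappa> * q * sum c (B - A) \<le> 4 * L * path_cost"
proof (cases "path_cost = 0")
  \<comment> \<open>The density \<open>\<rho>\<close> used below divides by
    \<open>path_cost\<close>. If that is zero, realizations of positive weight probe nothing, so
    \<open>ghost\<close> already forces the unfinished mass of \<open>A\<close> to be zero.\<close>
  case True
  have prod_zero: "w x * sum c (probes x) = 0" if "x \<in> \<Omega>" for x
    using sum_nonneg_0[OF finite(1) _ True that] w_nonneg sum_path_nonneg by simp
  have zero: "w x = 0 \<or> probes x = {}" if "x \<in> \<Omega>" for x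
  proof -
    have "sum c (probes x) > 0" if "probes x \<noteq> {}"
      using probes[OF \<open>x \<in> \<Omega>\<close>] c_pos that finite(2) by (intro sum_pos) (auto intro: finite_subset)
    then show ?thesis using prod_zero[OF that] by fastforce
  qed
  have "\<kappa> * (unf_mass A)\<^sup>2 \<le> 0"
  proof (rule order_trans[OF ghost[OF A]], intro sum_nonpos)
    fix x y assume "x \<in> {x \<in> \<Omega>. unf A x}"
    then show "w x * w y * (\<Sum>e\<in>probes x - A. \<Phi> (insert e A) y - \<Phi> A y) \<le> 0" using zero[of x] by auto
  qed
  then have "unf_mass A = 0" using kappa by (simp add: mult_le_0_iff)
  then show thesis using that[of A] A q True by simp
next
  case False
  then have V: "path_cost > 0" using path_cost_nonneg by simp
  \<comment> \<open>Chosen so that the bound \<open>\<rho> * path_cost\<close> on the right of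
    \<open>ghost\<close> equals \<open>\<kappa> * (q / 2)\<^sup>2\<close>, hence the maximizer
    leaves mass at most \<open>q / 2\<close>.\<close>
  define \<rho> where "\<rho> = \<kappa> * q\<^sup>2 / (4 * path_cost)"
  have rho: "\<rho> > 0" using V kappa q by (simp add: \<rho>_def)
  define \<Psi> where "\<Psi> = (\<lambda>B. (\<Sum>x\<in>\<Omega>. w x * \<Phi> B x) - \<rho> * sum c B)"
  define \<B> where "\<B> = {B. A \<subseteq> B \<and> B \<subseteq> I}"
  have "finite \<B>" using finite(2) by (auto simp: \<B>_def intro: finite_subset[of _ "Pow I"])
  moreover have "A \<in> \<B>" using A by (simp add: \<B>_def)
  ultimately obtain B where B: "B \<in> \<B>" "\<And>B'. B' \<in> \<B> \<Longrightarrow> \<Psi> B' \<le> \<Psi> B"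
    using finite_argmax[of \<B> \<Psi>] by blast
  have AB: "A \<subseteq> B" "B \<subseteq> I" "A0 \<subseteq> B" using B(1) A by (auto simp: \<B>_def)
  have finB: "finite B" "finite A" using AB finite(2) by (auto intro: finite_subset)
  have item: "(\<Sum>y\<in>\<Omega>. w y * (\<Phi> (insert e B) y - \<Phi> B y)) \<le> \<rho> * c e" if "e \<in> I" "e \<notin> B" for e
    using B(2)[of "insert e B"] that AB finB
    by (auto simp: \<B>_def \<Psi>_def sum_subtractf algebra_simps)
  have "\<kappa> * (unf_mass B)\<^sup>2 \<le> (\<Sum>x | x \<in> \<Omega> \<and> unf B x. \<Sum>y | y \<in> \<Omega> \<and> unf B y.
         w x * w y * (\<Sum>e\<in>probes x - B. \<Phi> (insert e B) y - \<Phi> B y))"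
    by (rule ghost[OF AB(3,2)])
  also have "\<dots> = (\<Sum>x | x \<in> \<Omega> \<and> unf B x. w x * (\<Sum>e\<in>probes x - B. \<Sum>y | y \<in> \<Omega> \<and> unf B y.
         w y * (\<Phi> (insert e B) y - \<Phi> B y)))"
    by (subst sum.swap) (simp add: sum_distrib_left mult_ac)
  also have "\<dots> \<le> (\<Sum>x | x \<in> \<Omega> \<and> unf B x. w x * (\<rho> * sum c (probes x)))"
  proof (intro sum_mono mult_left_mono)
    fix x assume x: "x \<in> {x \<in> \<Omega>. unf B x}"
    then have px: "probes x \<subseteq> I" using probes by auto
    have "(\<Sum>e\<in>probes x - B. \<Sum>y | y \<in> \<Omega> \<and> unf B y. w y * (\<Phi> (insert e B) y - \<Phi> B y))
        \<le> (\<Sum>e\<in>probes x - B. \<rho> * c e)"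
    proof (rule sum_mono)
      fix e assume e: "e \<in> probes x - B"
      have "(\<Sum>y | y \<in> \<Omega> \<and> unf B y. w y * (\<Phi> (insert e B) y - \<Phi> B y))
          \<le> (\<Sum>y\<in>\<Omega>. w y * (\<Phi> (insert e B) y - \<Phi> B y))"
        using finite w_nonneg Phi_step AB e px by (intro sum_mono2) auto
      also have "\<dots> \<le> \<rho> * c e" using item[of e] e px by auto
      finally show "(\<Sum>y | y \<in> \<Omega> \<and> unf B y. w y * (\<Phi> (insert e B) y - \<Phi> B y)) \<le> \<rho> * c e" .
    qed
    also have "\<dots> \<le> (\<Sum>e\<in>probes x. \<rho> * c e)"
      using px finite(2) c_pos rho
      by (intro sum_mono2) (auto intro: finite_subset mult_nonneg_nonneg less_imp_le)
    finally show "(\<Sum>e\<in>probes x - B. \<Sum>y | y \<in> \<Omega> \<and> unf B y. w y * (\<Phi> (insert e B) y - \<Phi> B y))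
        \<le> \<rho> * sum c (probes x)" by (simp add: sum_distrib_left)
  qed (use w_nonneg in auto)
  also have "\<dots> \<le> (\<Sum>x\<in>\<Omega>. w x * (\<rho> * sum c (probes x)))"
    using finite w_nonneg rho sum_path_nonneg by (intro sum_mono2) auto
  also have "\<dots> = \<rho> * path_cost" by (simp add: sum_distrib_left mult_ac)
  also have "\<dots> = \<kappa> * (q / 2)\<^sup>2" using V by (simp add: \<rho>_def power2_eq_square)
  finally have "(unf_mass B)\<^sup>2 \<le> (q / 2)\<^sup>2" using kappa by simp
  then have half: "unf_mass B \<le> q / 2" by (rule power2_le_imp_le) (use q in simp)
  \<comment> \<open>The cost side: maximality against \<open>A\<close> itself says that the added
    items are paid for by potential, and only the mass unfinished at \<open>A\<close> can gain, each
    realization at most \<open>L\<close>.\<close>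
  have "\<rho> * sum c (B - A) = \<rho> * sum c B - \<rho> * sum c A"
    using AB finB by (simp add: sum_diff algebra_simps)
  also have "\<dots> \<le> (\<Sum>x\<in>\<Omega>. w x * (\<Phi> B x - \<Phi> A x))"
    using B(2)[OF \<open>A \<in> \<B>\<close>] by (simp add: \<Psi>_def sum_subtractf algebra_simps)
  also have "\<dots> = (\<Sum>x | x \<in> \<Omega> \<and> unf A x. w x * (\<Phi> B x - \<Phi> A x))"
    using finite Phi_finished[OF A(1) AB(1,2)] by (intro sum.mono_neutral_right) force+
  also have "\<dots> \<le> (\<Sum>x | x \<in> \<Omega> \<and> unf A x. w x * L)"
  proof (intro sum_mono mult_left_mono)
    fix x assume x: "x \<in> {x \<in> \<Omega>. unf A x}"
    show "\<Phi> B x - \<Phi> A x \<le> L" using Phi_bounds[of A x] Phi_bounds[of B x] A AB x by auto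
  qed (use w_nonneg in auto)
  also have "\<dots> = unf_mass A * L" by (simp add: sum_distrib_right)
  also have "\<dots> \<le> q * L"
  proof (cases "\<Omega> = {}")
    case False
    then obtain x where "x \<in> \<Omega>" by auto
    then have "L \<ge> 0" using Phi_bounds[of A x] A by auto
    then show ?thesis using q by (simp add: mult_right_mono)
  qed (use V in simp)
  finally have "\<rho> * sum c (B - A) \<le> q * L" .
  then have "\<kappa> * q * sum c (B - A) \<le> 4 * L * path_cost"
    using V q by (simp add: \<rho>_def field_simps power2_eq_square)
  then show thesis using that half AB by blast
qed

text \<open>Each halving costs twice as much as the one before, and
  \<open>1 + 2 + ... + 2 ^ (n - 1) = 2 ^ n - 1\<close>.\<close>

lemma unfinished_power_two:
  assumes W: "(\<Sum>x\<in>\<Omega>. w x) > 0"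
  shows "\<exists>B. A0 \<subseteq> B \<and> B \<subseteq> I \<and> unf_mass B \<le> (\<Sum>x\<in>\<Omega>. w x) / 2 ^ n \<and>
    \<kappa> * (\<Sum>x\<in>\<Omega>. w x) * sum c (B - A0) \<le> 4 * L * path_cost * (2 ^ n - 1)"
proof (induction n)
  case 0
  have "unf_mass A0 \<le> (\<Sum>x\<in>\<Omega>. w x)" using finite w_nonneg by (intro sum_mono2) auto
  then show ?case using A0 by (intro exI[of _ A0]) simp
next
  case (Suc n)
  let ?W = "\<Sum>x\<in>\<Omega>. w x"
  from Suc obtain A where A: "A0 \<subseteq> A" "A \<subseteq> I" "unf_mass A \<le> ?W / 2 ^ n"
    "\<kappa> * ?W * sum c (A - A0) \<le> 4 * L * path_cost * (2 ^ n - 1)" by auto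
  from halve_unfinished[OF A(1-3)] W obtain B where B: "A \<subseteq> B" "B \<subseteq> I"
    "unf_mass B \<le> ?W / 2 ^ n / 2" "\<kappa> * (?W / 2 ^ n) * sum c (B - A) \<le> 4 * L * path_cost" by auto
  have "finite B" using B finite(2) by (auto intro: finite_subset)
  then have "sum c (B - A0) = sum c (B - A) + sum c (A - A0)"
    using A B by (subst sum.union_disjoint[symmetric]) (auto intro: finite_subset arg_cong[where f="sum c"])
  moreover have "\<kappa> * ?W * sum c (B - A) \<le> 4 * L * path_cost * 2 ^ n"
    using B(4) by (simp add: field_simps)
  ultimately have "\<kappa> * ?W * sum c (B - A0) \<le> 4 * L * path_cost * (2 ^ Suc n - 1)"
    using A(4) by (simp add: algebra_simps)
  then show ?case using A B by (intro exI[of _ B]) (auto simp: mult.commute)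
qed

lemma one_round:
  assumes W: "(\<Sum>x\<in>\<Omega>. w x) > 0" and eta: "\<eta> > 0"
  obtains B where "A0 \<subseteq> B" "B \<subseteq> I" "unf_mass B \<le> \<eta> * (\<Sum>x\<in>\<Omega>. w x)"
    "\<kappa> * \<eta> * sum c (B - A0) * (\<Sum>x\<in>\<Omega>. w x) \<le> 8 * L * path_cost"
proof -
  let ?W = "\<Sum>x\<in>\<Omega>. w x"
  define n where "n = (LEAST n. 1 / 2 ^ n \<le> \<eta>)"
  have "\<exists>n. (1/2) ^ n < \<eta>" using real_arch_pow_inv[OF eta, of "1/2"] by simp
  then obtain n0 where "1 / 2 ^ n0 \<le> \<eta>" by (auto simp: power_divide intro: less_imp_le)
  then have n: "1 / 2 ^ n \<le> \<eta>" unfolding n_def by (rule LeastI)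
  \<comment> \<open>Minimality of \<open>n\<close> gives
    \<open>2 ^ (n - 1) \<le> 1 / \<eta>\<close>, so the geometric sum is at most
    \<open>2 / \<eta>\<close>; this doubles the constant from 4 to 8.\<close>
  have n': "\<eta> * (2 ^ n - 1) \<le> 2"
  proof (cases n)
    case (Suc k)
    then have "\<not> 1 / 2 ^ k \<le> \<eta>" using not_less_Least[of k "\<lambda>n. 1 / 2 ^ n \<le> \<eta>"] by (simp add: n_def)
    then have "\<eta> * 2 ^ k \<le> 1" by (simp add: field_simps)
    then show ?thesis using Suc eta by (simp add: algebra_simps)
  qed simp
  from unfinished_power_two[OF W, of n] obtain B where B: "A0 \<subseteq> B" "B \<subseteq> I" "unf_mass B \<le> ?W / 2 ^ n"
    "\<kappa> * ?W * sum c (B - A0) \<le> 4 * L * path_cost * (2 ^ n - 1)" by auto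
  have mass: "unf_mass B \<le> \<eta> * ?W" using B(3) mult_right_mono[OF n, of ?W] W by simp
  have "\<Omega> \<noteq> {}" using W by auto
  then obtain x where "x \<in> \<Omega>" by auto
  then have "L \<ge> 0" using Phi_bounds[of A0 x] A0 by auto
  have "\<kappa> * \<eta> * sum c (B - A0) * ?W = \<eta> * (\<kappa> * ?W * sum c (B - A0))" by simp
  also have "\<dots> \<le> \<eta> * (4 * L * path_cost * (2 ^ n - 1))" using B(4) eta by (intro mult_left_mono) auto
  also have "\<dots> = 4 * L * path_cost * (\<eta> * (2 ^ n - 1))" by simp
  also have "\<dots> \<le> 4 * L * path_cost * 2" using n' \<open>L \<ge> 0\<close> path_cost_nonneg
    by (intro mult_left_mono) auto
  finally have "\<kappa> * \<eta> * sum c (B - A0) * ?W \<le> 8 * L * path_cost" by simp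
  then show thesis using that B mass by blast
qed

end

subsection \<open>Composition of rounds\<close>

lemma dom_observe [simp]: "dom (observe \<omega> S) = S"
  by (auto simp: observe_def split: if_splits)

lemma observe_eq_iff: "observe \<omega> A = observe \<omega>' A \<longleftrightarrow> (\<forall>i\<in>A. \<omega> i = \<omega>' i)"
  by (auto simp: observe_def fun_eq_iff)

lemma observe_add: "observe \<omega> A ++ observe \<omega> B = observe \<omega> (A \<union> B)"
  by (auto simp: observe_def map_add_def fun_eq_iff)

text \<open>The conditioning event of an observation.\<close>

definition cyl :: "(nat \<Rightarrow> 'a) set \<Rightarrow> 'a obs \<Rightarrow> (nat \<Rightarrow> 'a) set" where
  "cyl \<Omega> ob = {\<omega>\<in>\<Omega>. observe \<omega> (dom ob) = ob}"

lemma observe_dom_round_obs: "observe \<omega> (dom (round_obs \<sigma> \<omega> k)) = round_obs \<sigma> \<omega> k"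
proof (induction k)
  case (Suc k)
  have "round_obs \<sigma> \<omega> (Suc k) = observe \<omega> (dom (round_obs \<sigma> \<omega> k)) ++ observe \<omega> (\<sigma> k (round_obs \<sigma> \<omega> k))"
    using Suc by simp
  then show ?case by (simp only: observe_add dom_observe)
qed (simp add: observe_def)

lemma round_obs_cong:
  "observe \<omega>' (dom (round_obs \<sigma> \<omega> k)) = round_obs \<sigma> \<omega> k \<Longrightarrow> round_obs \<sigma> \<omega>' k = round_obs \<sigma> \<omega> k"
proof (induction k)
  case (Suc k)
  let ?o = "round_obs \<sigma> \<omega> k"
  have "observe \<omega>' (dom ?o \<union> \<sigma> k ?o) = observe \<omega> (dom ?o \<union> \<sigma> k ?o)"
    using Suc.prems observe_dom_round_obs[of \<omega> \<sigma> "Suc k"] by (simp add: Un_commute)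
  then have agree: "\<forall>i\<in>dom ?o \<union> \<sigma> k ?o. \<omega>' i = \<omega> i" by (simp add: observe_eq_iff)
  then have "observe \<omega>' (dom ?o) = observe \<omega> (dom ?o)" "observe \<omega>' (\<sigma> k ?o) = observe \<omega> (\<sigma> k ?o)"
    by (auto simp: observe_eq_iff)
  then show ?case using Suc.IH observe_dom_round_obs[of \<omega> \<sigma> k] by simp
qed simp

text \<open>A history contains the outcomes of everything probed, and these determine the later
  choices. So conditioning on a history only fixes coordinates, which keeps independent items
  independent.\<close>

lemma round_obs_fibre:
  assumes "ob \<in> (\<lambda>\<omega>. round_obs \<sigma> \<omega> k) ` \<Omega>"
  shows "{\<omega>\<in>\<Omega>. round_obs \<sigma> \<omega> k = ob} = cyl \<Omega> ob" "cyl \<Omega> ob \<noteq> {}"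
proof -
  show *: "{\<omega>\<in>\<Omega>. round_obs \<sigma> \<omega> k = ob} = cyl \<Omega> ob"
  proof (intro set_eqI iffI)
    fix \<omega> assume "\<omega> \<in> {\<omega>\<in>\<Omega>. round_obs \<sigma> \<omega> k = ob}"
    then show "\<omega> \<in> cyl \<Omega> ob" using observe_dom_round_obs[of \<omega> \<sigma> k] by (auto simp: cyl_def)
  next
    fix \<omega> assume "\<omega> \<in> cyl \<Omega> ob"
    with assms show "\<omega> \<in> {\<omega>\<in>\<Omega>. round_obs \<sigma> \<omega> k = ob}"
      using round_obs_cong[of \<omega> \<sigma> _ k] by (auto simp: cyl_def)
  qed
  show "cyl \<Omega> ob \<noteq> {}" using assms by (auto simp flip: *)
qed

lemma sum_over_round_obs:
  assumes "finite \<Omega>"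
  shows "(\<Sum>\<omega>\<in>\<Omega>. h \<omega>) = (\<Sum>ob\<in>(\<lambda>\<omega>. round_obs \<sigma> \<omega> k) ` \<Omega>. \<Sum>\<omega>\<in>cyl \<Omega> ob. h \<omega>)"
proof -
  have "(\<Sum>\<omega>\<in>\<Omega>. h \<omega>) = (\<Sum>ob\<in>(\<lambda>\<omega>. round_obs \<sigma> \<omega> k) ` \<Omega>. sum h {\<omega>\<in>\<Omega>. round_obs \<sigma> \<omega> k = ob})"
    using assms by (intro sum.group[symmetric]) auto
  then show ?thesis by (simp add: round_obs_fibre cong: sum.cong)
qed

text \<open>\<open>G k A \<omega>\<close> means that the run is on schedule after \<open>k\<close>
  rounds with probed set \<open>A\<close>. The cost of a round is charged, observation by
  observation, to the \<open>v\<close>-mass of the cylinder; the cylinders partition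
  \<open>\<Omega>\<close>, so every round costs at most \<open>M k\<close> times the total. Failures
  add up by a union bound over the first round that falls behind.\<close>

lemma compose_rounds:
  fixes G :: "nat \<Rightarrow> nat set \<Rightarrow> (nat \<Rightarrow> 'a) \<Rightarrow> bool"
  assumes fin: "finite \<Omega>" "finite I" and w: "\<And>\<omega>. \<omega> \<in> \<Omega> \<Longrightarrow> w \<omega> \<ge> 0"
    and v: "\<And>\<omega>. \<omega> \<in> \<Omega> \<Longrightarrow> v \<omega> \<ge> 0"
    and M: "\<And>k. k < r \<Longrightarrow> M k \<ge> 0" and eta: "\<And>k. k < r \<Longrightarrow> \<eta> k \<ge> 0"
    and G0: "\<And>\<omega>. \<omega> \<in> \<Omega> \<Longrightarrow> G 0 {} \<omega>"
    and Gcong: "\<And>k A \<omega> \<omega>'. G k A \<omega> \<Longrightarrow> observe \<omega> A = observe \<omega>' A \<Longrightarrow> G k A \<omega>'"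
    and step: "\<And>k ob. k < r \<Longrightarrow> dom ob \<subseteq> I \<Longrightarrow> cyl \<Omega> ob \<noteq> {} \<Longrightarrow> (\<forall>\<omega>\<in>cyl \<Omega> ob. G k (dom ob) \<omega>) \<Longrightarrow>
      \<exists>B. dom ob \<subseteq> B \<and> B \<subseteq> I \<and> sum c (B - dom ob) * sum w (cyl \<Omega> ob) \<le> M k * sum v (cyl \<Omega> ob) \<and>
        sum w {\<omega>\<in>cyl \<Omega> ob. \<not> G (Suc k) B \<omega>} \<le> \<eta> k * sum w (cyl \<Omega> ob)"
  obtains \<sigma> where "\<And>k ob. \<sigma> k ob \<subseteq> I"
    "(\<Sum>\<omega>\<in>\<Omega>. w \<omega> * rounds_cost c r \<sigma> \<omega>) \<le> (\<Sum>k<r. M k) * sum v \<Omega>"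
    "sum w {\<omega>\<in>\<Omega>. \<not> G r (dom (round_obs \<sigma> \<omega> r)) \<omega>} \<le> (\<Sum>k<r. \<eta> k) * sum w \<Omega>"
proof -
  define P where "P = (\<lambda>k ob B. dom ob \<subseteq> B \<and> B \<subseteq> I \<and>
    sum c (B - dom ob) * sum w (cyl \<Omega> ob) \<le> M k * sum v (cyl \<Omega> ob) \<and>
    sum w {\<omega>\<in>cyl \<Omega> ob. \<not> G (Suc k) B \<omega>} \<le> \<eta> k * sum w (cyl \<Omega> ob))"
  \<comment> \<open>Items of \<open>dom ob\<close> are removed because \<open>rounds_cost\<close>
    would charge them again. Without a suitable \<open>B\<close> the round is empty and costs
    nothing.\<close>
  define \<sigma> where "\<sigma> = (\<lambda>k ob. if \<exists>B. P k ob B then (SOME B. P k ob B) - dom ob else {})"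
  have P: "P k ob (dom ob \<union> \<sigma> k ob)" if "P k ob B" for k ob B
  proof -
    have "P k ob (SOME B. P k ob B)" using that by (rule someI)
    moreover from this have "dom ob \<union> \<sigma> k ob = (SOME B. P k ob B)"
      using that by (auto simp: \<sigma>_def P_def)
    ultimately show ?thesis by simp
  qed
  have sub: "\<sigma> k ob \<subseteq> I" for k ob
  proof (cases "\<exists>B. P k ob B")
    case True
    then show ?thesis using P[of k ob] by (auto simp: P_def)
  qed (auto simp: \<sigma>_def)
  have dom_I: "dom (round_obs \<sigma> \<omega> k) \<subseteq> I" for \<omega> k
    using sub by (induction k) auto
  have cylfin: "finite (cyl \<Omega> ob)" "cyl \<Omega> ob \<subseteq> \<Omega>" for ob using fin by (auto simp: cyl_def)
  let ?ob = "\<lambda>k \<omega>. round_obs \<sigma> \<omega> k"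
  have cost: "(\<Sum>\<omega>\<in>\<Omega>. w \<omega> * sum c (\<sigma> k (?ob k \<omega>))) \<le> M k * sum v \<Omega>" if k: "k < r" for k
  proof -
    have "(\<Sum>\<omega>\<in>\<Omega>. w \<omega> * sum c (\<sigma> k (?ob k \<omega>)))
        = (\<Sum>ob\<in>?ob k ` \<Omega>. \<Sum>\<omega>\<in>cyl \<Omega> ob. w \<omega> * sum c (\<sigma> k (?ob k \<omega>)))"
      by (rule sum_over_round_obs[OF fin(1)])
    also have "\<dots> = (\<Sum>ob\<in>?ob k ` \<Omega>. \<Sum>\<omega>\<in>cyl \<Omega> ob. w \<omega> * sum c (\<sigma> k ob))"
      by (intro sum.cong refl) (auto simp flip: round_obs_fibre(1))
    also have "\<dots> \<le> (\<Sum>ob\<in>?ob k ` \<Omega>. M k * sum v (cyl \<Omega> ob))"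
    proof (rule sum_mono)
      fix ob
      have V: "sum v (cyl \<Omega> ob) \<ge> 0" using v cylfin(2) by (intro sum_nonneg) auto
      show "(\<Sum>\<omega>\<in>cyl \<Omega> ob. w \<omega> * sum c (\<sigma> k ob)) \<le> M k * sum v (cyl \<Omega> ob)"
      proof (cases "\<exists>B. P k ob B")
        case True
        then have "P k ob (dom ob \<union> \<sigma> k ob)" using P by blast
        moreover have "dom ob \<union> \<sigma> k ob - dom ob = \<sigma> k ob" by (auto simp: \<sigma>_def)
        ultimately show ?thesis by (simp add: P_def sum_distrib_right mult.commute)
      next
        case False
        then have "\<sigma> k ob = {}" by (auto simp: \<sigma>_def)
        then show ?thesis using V M[OF k] by simp
      qed
    qed
    also have "\<dots> = M k * sum v \<Omega>"
      by (subst sum_over_round_obs[OF fin(1), of v \<sigma> k]) (simp add: sum_distrib_left)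
    finally show ?thesis .
  qed
  have "(\<Sum>\<omega>\<in>\<Omega>. w \<omega> * rounds_cost c r \<sigma> \<omega>) = (\<Sum>k<r. \<Sum>\<omega>\<in>\<Omega>. w \<omega> * sum c (\<sigma> k (?ob k \<omega>)))"
    unfolding rounds_cost_def sum_distrib_left by (rule sum.swap)
  also have "\<dots> \<le> (\<Sum>k<r. M k) * sum v \<Omega>"
    using cost by (auto simp: sum_distrib_right intro!: sum_mono)
  finally have total: "(\<Sum>\<omega>\<in>\<Omega>. w \<omega> * rounds_cost c r \<sigma> \<omega>) \<le> (\<Sum>k<r. M k) * sum v \<Omega>" .
  have bad: "sum w {\<omega>\<in>\<Omega>. \<not> G k (dom (?ob k \<omega>)) \<omega>} \<le> (\<Sum>j<k. \<eta> j) * sum w \<Omega>" if "k \<le> r" for k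
    using that
  proof (induction k)
    case 0
    have "{\<omega>\<in>\<Omega>. \<not> G 0 {} \<omega>} = {}" using G0 by auto
    then show ?case by (simp del: Collect_empty_eq)
  next
    case (Suc k)
    let ?b = "\<lambda>k \<omega>. \<not> G k (dom (?ob k \<omega>)) \<omega>"
    \<comment> \<open>Only realizations that fall behind in exactly this round are counted, since
      \<open>step\<close> speaks of cylinders that are still on schedule.\<close>
    have "sum w {\<omega>\<in>\<Omega>. ?b (Suc k) \<omega> \<and> \<not> ?b k \<omega>} = (\<Sum>\<omega>\<in>\<Omega>. if ?b (Suc k) \<omega> \<and> \<not> ?b k \<omega> then w \<omega> else 0)"
      using fin by (simp add: sum.inter_filter)
    also have "\<dots> = (\<Sum>ob\<in>?ob k ` \<Omega>. \<Sum>\<omega>\<in>cyl \<Omega> ob. if ?b (Suc k) \<omega> \<and> \<not> ?b k \<omega> then w \<omega> else 0)"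
      by (rule sum_over_round_obs[OF fin(1)])
    also have "\<dots> \<le> (\<Sum>ob\<in>?ob k ` \<Omega>. \<eta> k * sum w (cyl \<Omega> ob))"
    proof (rule sum_mono)
      fix ob assume ob: "ob \<in> ?ob k ` \<Omega>"
      have obk: "?ob k \<omega> = ob" if "\<omega> \<in> cyl \<Omega> ob" for \<omega>
        using that ob by (auto simp flip: round_obs_fibre(1))
      have agree: "observe \<omega> (dom ob) = observe \<omega>' (dom ob)" if "\<omega> \<in> cyl \<Omega> ob" "\<omega>' \<in> cyl \<Omega> ob" for \<omega> \<omega>'
        using that by (simp add: cyl_def)
      have W: "sum w (cyl \<Omega> ob) \<ge> 0" using w cylfin(2) by (intro sum_nonneg) auto
      show "(\<Sum>\<omega>\<in>cyl \<Omega> ob. if ?b (Suc k) \<omega> \<and> \<not> ?b k \<omega> then w \<omega> else 0) \<le> \<eta> k * sum w (cyl \<Omega> ob)"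
      proof (cases "\<forall>\<omega>\<in>cyl \<Omega> ob. G k (dom ob) \<omega>")
        case True
        have "dom ob \<subseteq> I" using ob dom_I by auto
        then have "\<exists>B. P k ob B"
          using step[of k ob] True round_obs_fibre(2)[OF ob] Suc.prems unfolding P_def by simp
        then have "P k ob (dom ob \<union> \<sigma> k ob)" using P by blast
        then have "sum w {\<omega>\<in>cyl \<Omega> ob. \<not> G (Suc k) (dom ob \<union> \<sigma> k ob) \<omega>} \<le> \<eta> k * sum w (cyl \<Omega> ob)"
          by (simp add: P_def)
        moreover have "(\<Sum>\<omega>\<in>cyl \<Omega> ob. if ?b (Suc k) \<omega> \<and> \<not> ?b k \<omega> then w \<omega> else 0)
            = (\<Sum>\<omega>\<in>cyl \<Omega> ob. if \<not> G (Suc k) (dom ob \<union> \<sigma> k ob) \<omega> then w \<omega> else 0)"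
          using True by (intro sum.cong refl) (simp add: obk Un_commute)
        ultimately show ?thesis using cylfin by (simp add: sum.inter_filter)
      next
        case False
        \<comment> \<open>By \<open>Gcong\<close> a cylinder is on schedule as a whole or not at
          all, so here nobody falls behind for the first time.\<close>
        then have "\<not> G k (dom ob) \<omega>" if "\<omega> \<in> cyl \<Omega> ob" for \<omega>
          using Gcong agree that by blast
        then have "(\<Sum>\<omega>\<in>cyl \<Omega> ob. if ?b (Suc k) \<omega> \<and> \<not> ?b k \<omega> then w \<omega> else 0) = 0"
          by (intro sum.neutral) (simp add: obk)
        then show ?thesis using W eta Suc.prems by simp
      qed
    qed
    also have "\<dots> = \<eta> k * sum w \<Omega>"
      by (subst sum_over_round_obs[OF fin(1), of w \<sigma> k]) (simp add: sum_distrib_left)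
    finally have new: "sum w {\<omega>\<in>\<Omega>. ?b (Suc k) \<omega> \<and> \<not> ?b k \<omega>} \<le> \<eta> k * sum w \<Omega>" .
    have "sum w {\<omega>\<in>\<Omega>. ?b (Suc k) \<omega>} \<le> sum w ({\<omega>\<in>\<Omega>. ?b k \<omega>} \<union> {\<omega>\<in>\<Omega>. ?b (Suc k) \<omega> \<and> \<not> ?b k \<omega>})"
      using fin w by (intro sum_mono2) auto
    also have "\<dots> = sum w {\<omega>\<in>\<Omega>. ?b k \<omega>} + sum w {\<omega>\<in>\<Omega>. ?b (Suc k) \<omega> \<and> \<not> ?b k \<omega>}"
      using fin by (intro sum.union_disjoint) auto
    also have "\<dots> \<le> (\<Sum>j<Suc k. \<eta> j) * sum w \<Omega>"
      using new Suc by (simp add: algebra_simps)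
    finally show ?case .
  qed
  show thesis using that[OF sub total bad] by simp
qed

subsection \<open>Adaptive policies\<close>

text \<open>The only property of the item sets probed by a deterministic adaptive policy that matters here.\<close>
definition decision_path :: "((nat \<Rightarrow> 'a) \<Rightarrow> nat set) \<Rightarrow> bool" where
  "decision_path probes \<longleftrightarrow> (\<forall>\<omega> \<omega>'. probes \<omega> = probes \<omega>' \<and> (\<forall>i\<in>probes \<omega>. \<omega> i = \<omega>' i) \<or>
     (\<exists>e\<in>probes \<omega> \<inter> probes \<omega>'. \<omega> e \<noteq> \<omega>' e))"

text \<open>The runs on \<open>\<omega>\<close> and on the changed realization can part only at an
  item where these differ, which is \<open>e\<close> itself, and then both runs probe
  \<open>e\<close>.\<close>

lemma decision_path_resample:
  assumes "decision_path probes"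
  shows "e \<in> probes (fun_upd \<omega> e a) \<longleftrightarrow> e \<in> probes \<omega>"
  using assms[unfolded decision_path_def, rule_format, of \<omega> "fun_upd \<omega> e a"] by (auto split: if_splits)

lemma adapt_step_invariant:
  fixes \<omega> :: "nat \<Rightarrow> 'a"
  shows "(adapt_step m \<pi> \<omega> ^^ n) Map.empty = observe \<omega> (dom ((adapt_step m \<pi> \<omega> ^^ n) Map.empty)) \<and>
    dom ((adapt_step m \<pi> \<omega> ^^ n) Map.empty) \<subseteq> {..<m}"
proof (induction n)
  case (Suc n)
  define ob where "ob = (adapt_step m \<pi> \<omega> ^^ n) Map.empty"
  have IH: "ob = observe \<omega> (dom ob)" "dom ob \<subseteq> {..<m}" using Suc by (simp_all add: ob_def)
  have "ob(i \<mapsto> \<omega> i) = observe \<omega> (insert i (dom ob))" for i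
    by (subst IH(1)) (auto simp: observe_def fun_eq_iff)
  then have "adapt_step m \<pi> \<omega> ob = observe \<omega> (dom (adapt_step m \<pi> \<omega> ob)) \<and> dom (adapt_step m \<pi> \<omega> ob) \<subseteq> {..<m}"
    using IH by (auto simp: adapt_step_def split: option.split)
  then show ?case by (simp add: ob_def)
qed (simp add: observe_def)

lemma adapt_final_subset: "dom (adapt_final m \<pi> \<omega>) \<subseteq> {..<m}"
  using adapt_step_invariant[where m=m and n=m and \<pi>=\<pi> and \<omega>=\<omega>] by (simp add: adapt_final_def)

text \<open>Run both realizations in lockstep: the observations stay equal until both runs probe an
  item with different outcomes, and probed items are never forgotten.\<close>

lemma decision_path_adapt_final: "decision_path (\<lambda>\<omega>. dom (adapt_final m \<pi> \<omega>))"
proof -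
  let ?s = "\<lambda>\<omega> n. (adapt_step m \<pi> \<omega> ^^ n) Map.empty"
  have sync: "?s \<omega> n = ?s \<omega>' n \<or> (\<exists>e\<in>dom (?s \<omega> n) \<inter> dom (?s \<omega>' n). \<omega> e \<noteq> \<omega>' e)" for \<omega> \<omega>' n
  proof (induction n)
    case (Suc n)
    have mono: "dom ob \<subseteq> dom (adapt_step m \<pi> x ob)" for x ob
      by (auto simp: adapt_step_def split: option.split)
    from Suc show ?case
    proof
      assume eq: "?s \<omega> n = ?s \<omega>' n"
      have "adapt_step m \<pi> \<omega> ob = adapt_step m \<pi> \<omega>' ob \<or>
          (\<exists>e\<in>dom (adapt_step m \<pi> \<omega> ob) \<inter> dom (adapt_step m \<pi> \<omega>' ob). \<omega> e \<noteq> \<omega>' e)" for ob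
        by (auto simp: adapt_step_def split: option.split)
      then show ?thesis using eq by simp
    next
      assume "\<exists>e\<in>dom (?s \<omega> n) \<inter> dom (?s \<omega>' n). \<omega> e \<noteq> \<omega>' e"
      then show ?thesis using mono[of "?s \<omega> n" \<omega>] mono[of "?s \<omega>' n" \<omega>'] by auto
    qed
  qed simp
  show ?thesis unfolding decision_path_def
  proof (intro allI)
    fix \<omega> \<omega>'
    show "dom (adapt_final m \<pi> \<omega>) = dom (adapt_final m \<pi> \<omega>') \<and> (\<forall>i\<in>dom (adapt_final m \<pi> \<omega>). \<omega> i = \<omega>' i) \<or>
     (\<exists>e\<in>dom (adapt_final m \<pi> \<omega>) \<inter> dom (adapt_final m \<pi> \<omega>'). \<omega> e \<noteq> \<omega>' e)"
      using sync[where \<omega>=\<omega> and \<omega>'=\<omega>' and n=m] adapt_step_invariant[where m=m and \<pi>=\<pi> and \<omega>=\<omega> and n=m]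
        adapt_step_invariant[where m=m and \<pi>=\<pi> and \<omega>=\<omega>' and n=m]
      by (auto simp: adapt_final_def)
  qed
qed

text \<open>Serves to show that the set under the infimum in \<open>OPT\<close> is nonempty.\<close>

lemma probe_all_policy:
  obtains \<pi> :: "'a obs \<Rightarrow> nat option" where "\<And>\<omega>. dom (adapt_final m \<pi> \<omega>) = {..<m}"
proof -
  define \<pi> :: "'a obs \<Rightarrow> nat option" where "\<pi> = (\<lambda>ob. Some (LEAST i. ob i = None))"
  have "(adapt_step m \<pi> \<omega> ^^ n) Map.empty = observe \<omega> {..<n}" if "n \<le> m" for n \<omega>
    using that
  proof (induction n)
    case (Suc n)
    have "(LEAST i. observe \<omega> {..<n} i = None) = n"
      by (rule Least_equality) (auto simp: observe_def split: if_splits)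
    then show ?case using Suc by (auto simp: adapt_step_def \<pi>_def observe_def fun_eq_iff)
  qed (simp add: observe_def)
  then show thesis using that[of \<pi>] by (simp add: adapt_final_def)
qed

text \<open>There may be infinitely many policies, but a cost depends only on the probed set of each
  realization in the finite support. The infimum is thus over a finite set and is a minimum.\<close>

lemma OPT_attained:
  fixes D :: "(nat \<Rightarrow> 'a) pmf"
  assumes fin: "finite (set_pmf D)" and inst: "cover_instance U f m c D"
  obtains probes where "decision_path probes" "\<And>\<omega>. probes \<omega> \<subseteq> {..<m}"
    "\<And>\<omega>. \<omega> \<in> set_pmf D \<Longrightarrow> f (\<omega> ` probes \<omega>) = f U"
    "OPT m c U f D = (\<Sum>\<omega>\<in>set_pmf D. pmf D \<omega> * sum c (probes \<omega>))"
proof -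
  define V where "V = {measure_pmf.expectation D (\<lambda>\<omega>. sum c (dom (adapt_final m \<pi> \<omega>))) | \<pi>.
       \<forall>\<omega>\<in>set_pmf D. f (\<omega> ` dom (adapt_final m \<pi> \<omega>)) = f U}"
  have E: "measure_pmf.expectation D h = (\<Sum>\<omega>\<in>set_pmf D. pmf D \<omega> * h \<omega>)" for h :: "_ \<Rightarrow> real"
    using fin by (subst integral_measure_pmf[of "set_pmf D"]) auto
  have "V \<subseteq> (\<lambda>g. \<Sum>\<omega>\<in>set_pmf D. pmf D \<omega> * sum c (g \<omega>)) ` (PiE (set_pmf D) (\<lambda>_. Pow {..<m}))"
  proof
    fix x assume "x \<in> V"
    then obtain \<pi> where x: "x = (\<Sum>\<omega>\<in>set_pmf D. pmf D \<omega> * sum c (dom (adapt_final m \<pi> \<omega>)))"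
      by (auto simp: V_def E)
    show "x \<in> (\<lambda>g. \<Sum>\<omega>\<in>set_pmf D. pmf D \<omega> * sum c (g \<omega>)) ` (PiE (set_pmf D) (\<lambda>_. Pow {..<m}))"
      unfolding x using adapt_final_subset[of m \<pi>]
      by (intro image_eqI[of _ _ "restrict (\<lambda>\<omega>. dom (adapt_final m \<pi> \<omega>)) (set_pmf D)"] sum.cong)
        (auto simp del: domIff)
  qed
  then have "finite V" by (rule finite_subset) (auto intro!: finite_imageI finite_PiE fin)
  moreover obtain \<pi>0 :: "'a obs \<Rightarrow> nat option" where "\<And>\<omega>. dom (adapt_final m \<pi>0 \<omega>) = {..<m}"
    using probe_all_policy by blast
  then have "V \<noteq> {}" using inst by (auto simp: V_def cover_instance_def intro!: exI[of _ \<pi>0])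
  ultimately have "Inf V \<in> V" by (metis cInf_eq_Min Min_in)
  then obtain \<pi> where "OPT m c U f D = (\<Sum>\<omega>\<in>set_pmf D. pmf D \<omega> * sum c (dom (adapt_final m \<pi> \<omega>)))"
    "\<forall>\<omega>\<in>set_pmf D. f (\<omega> ` dom (adapt_final m \<pi> \<omega>)) = f U"
    by (auto simp: V_def E OPT_def)
  then show thesis
    by (intro that[of "\<lambda>\<omega>. dom (adapt_final m \<pi> \<omega>)"] decision_path_adapt_final adapt_final_subset) auto
qed

subsection \<open>Independent items and scenarios\<close>

text \<open>Above the threshold this is \<open>ln x \<le> x - 1\<close>. At the threshold the
  logarithm is capped, as it would blow up for \<open>d' = 0\<close>; the extra 1 in the cap lets
  the last step still earn 1, the largest possible relative drop.\<close>

lemma capped_log_gain: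
  fixes d d' T \<delta> :: real
  assumes "0 < \<delta>" "0 < T" "\<delta> * T < d" "0 \<le> d'" "d' \<le> d"
  shows "(d - d') / d \<le> (if \<delta> * T < d' then ln (T / d') else 1 + ln (1 / \<delta>)) - ln (T / d)"
proof -
  have dT: "\<delta> * T > 0" using assms by simp
  then have d: "d > 0" using assms by linarith
  show ?thesis
  proof (cases "\<delta> * T < d'")
    case True
    then have d': "d' > 0" using dT by linarith
    have "ln (d' / d) \<le> d' / d - 1" using d d' by (intro ln_le_minus_one) simp
    then show ?thesis using True assms d d' by (simp add: ln_div diff_divide_distrib)
  next
    case False
    have "ln (\<delta> * T) \<le> ln d" using assms(3) dT d by (subst ln_le_cancel_iff) auto
    then have "1 \<le> 1 + ln (1 / \<delta>) - ln (T / d)" using assms d by (simp add: ln_div ln_mult)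
    moreover have "(d - d') / d \<le> 1" using assms d by simp
    ultimately show ?thesis using False by simp
  qed
qed

text \<open>Independence enters only through \<open>exch\<close>, which is symmetric in two
  realizations and therefore passes to cylinders. \<open>independent_copy_gain\<close> with
  \<open>\<tau> = \<delta> * T\<close> gives \<open>\<kappa> = \<delta> / 4\<close>, and
  \<open>8 / \<kappa>\<close> is the 32 over \<open>\<delta>\<close>.\<close>

lemma product_round:
  fixes f :: "'a set \<Rightarrow> nat" and \<Omega> :: "(nat \<Rightarrow> 'a) set"
  assumes ms: "monotone_submodular U f" and fin: "finite U" "finite \<Omega>" "finite I"
    and w: "\<And>\<omega>. \<omega> \<in> \<Omega> \<Longrightarrow> w \<omega> \<ge> 0" and c: "\<And>i. i \<in> I \<Longrightarrow> c i > 0"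
    and probes: "\<And>\<omega>. probes \<omega> \<subseteq> I" "decision_path probes"
    and cov: "\<And>\<omega>. \<omega> \<in> \<Omega> \<Longrightarrow> f (\<omega> ` probes \<omega>) = f U"
    and range: "\<And>\<omega> i. \<omega> \<in> \<Omega> \<Longrightarrow> i \<in> I \<Longrightarrow> \<omega> i \<in> U"
    and exch: "\<And>\<omega> \<omega>' e. \<omega> \<in> \<Omega> \<Longrightarrow> \<omega>' \<in> \<Omega> \<Longrightarrow> e \<in> I \<Longrightarrow> fun_upd \<omega> e (\<omega>' e) \<in> \<Omega>"
      "\<And>\<omega> \<omega>' e. \<omega> \<in> \<Omega> \<Longrightarrow> \<omega>' \<in> \<Omega> \<Longrightarrow> e \<in> I \<Longrightarrow>
         w (fun_upd \<omega> e (\<omega>' e)) * w (fun_upd \<omega>' e (\<omega> e)) = w \<omega> * w \<omega>'"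
    and A0: "A0 \<subseteq> I" "\<And>\<omega> \<omega>' i. \<omega> \<in> \<Omega> \<Longrightarrow> \<omega>' \<in> \<Omega> \<Longrightarrow> i \<in> A0 \<Longrightarrow> \<omega> i = \<omega>' i"
    and delta: "0 < \<delta>" "\<delta> \<le> 1" and T: "0 < T" "\<And>\<omega>. \<omega> \<in> \<Omega> \<Longrightarrow> real (f U) - real (f (\<omega> ` A0)) \<le> T"
    and W: "sum w \<Omega> > 0" and eta: "\<eta> > 0"
  shows "\<exists>B. A0 \<subseteq> B \<and> B \<subseteq> I \<and>
    sum c (B - A0) * sum w \<Omega> \<le> 32 * (1 + ln (1 / \<delta>)) / (\<delta> * \<eta>) * (\<Sum>\<omega>\<in>\<Omega>. w \<omega> * sum c (probes \<omega>)) \<and>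
    sum w {\<omega>\<in>\<Omega>. \<not> real (f U) - real (f (\<omega> ` B)) \<le> \<delta> * T} \<le> \<eta> * sum w \<Omega>"
proof -
  define d where "d = (\<lambda>(B :: nat set) (\<omega> :: nat \<Rightarrow> 'a). real (f U) - real (f (\<omega> ` B)))"
  define unf where "unf = (\<lambda>B \<omega>. \<delta> * T < d B \<omega>)"
  define L where "L = 1 + ln (1 / \<delta>)"
  define \<Phi> where "\<Phi> = (\<lambda>B \<omega>. if unf B \<omega> then ln (T / d B \<omega>) else L)"
  have dT: "\<delta> * T > 0" using delta T by simp
  have L: "L \<ge> 1" using delta by (simp add: L_def)
  have imU: "\<omega> ` B \<subseteq> U" if "\<omega> \<in> \<Omega>" "B \<subseteq> I" for \<omega> B using range that by auto
  have d_mono: "d B' \<omega> \<le> d B \<omega>" if "\<omega> \<in> \<Omega>" "B \<subseteq> B'" "B' \<subseteq> I" for \<omega> B B'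
    using monotone_submodular_mono[OF ms image_mono[OF that(2)] imU[OF that(1,3)]] by (simp add: d_def)
  have d_ins: "d (insert e B) \<omega> \<le> d B \<omega>" if "\<omega> \<in> \<Omega>" "B \<subseteq> I" "e \<in> I" for \<omega> B e
    using that by (intro d_mono) auto
  have d_nonneg: "0 \<le> d B \<omega>" if "\<omega> \<in> \<Omega>" "B \<subseteq> I" for \<omega> B
    using monotone_submodular_mono[OF ms imU[OF that]] by (simp add: d_def)
  have d_le: "d B \<omega> \<le> T" if "\<omega> \<in> \<Omega>" "B \<subseteq> I" "A0 \<subseteq> B" for \<omega> B
    using d_mono[OF that(1,3,2)] T(2)[OF that(1)] by (simp add: d_def)
  have gain: "(d B \<omega> - d (insert e B) \<omega>) / d B \<omega> \<le> \<Phi> (insert e B) \<omega> - \<Phi> B \<omega>"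
    if "\<omega> \<in> \<Omega>" "B \<subseteq> I" "e \<in> I" "unf B \<omega>" for B e \<omega>
    using capped_log_gain[OF delta(1) T(1), of "d B \<omega>" "d (insert e B) \<omega>"] that
      d_nonneg[of \<omega> "insert e B"] d_ins[of \<omega> B e] by (auto simp: \<Phi>_def unf_def L_def)
  have bounds: "0 \<le> \<Phi> B x \<and> \<Phi> B x \<le> L" if "A0 \<subseteq> B" "B \<subseteq> I" "x \<in> \<Omega>" for B x
    proof (cases "unf B x")
      case True
      then have dx: "d B x > 0" "\<delta> * T < d B x" using dT by (auto simp: unf_def)
      have "ln (T / d B x) \<le> ln (1 / \<delta>)"
        using dx delta T by (subst ln_le_cancel_iff) (auto simp: field_simps)
      then show ?thesis using True dx d_le[OF that(3,2,1)] by (simp add: \<Phi>_def L_def)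
    qed (use L in \<open>simp add: \<Phi>_def\<close>)
  have step: "\<Phi> B x \<le> \<Phi> (insert e B) x" if B: "A0 \<subseteq> B" "B \<subseteq> I" "e \<in> I" "x \<in> \<Omega>" for B e x
  proof -
    show "\<Phi> B x \<le> \<Phi> (insert e B) x"
    proof (cases "unf B x")
      case True
      have "0 \<le> (d B x - d (insert e B) x) / d B x"
        using d_ins[of x B e] d_nonneg[of x B] B by auto
      then show ?thesis using gain[of x B e] B True by auto
    next
      case False
      then have "\<not> unf (insert e B) x" using d_ins[of x B e] B by (auto simp: unf_def)
      with False show ?thesis by (simp add: \<Phi>_def)
    qed
  qed
  have finished: "\<Phi> B x = \<Phi> A x" if AB: "A0 \<subseteq> A" "A \<subseteq> B" "B \<subseteq> I" "x \<in> \<Omega>" "\<not> unf A x" for A B x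
  proof -
    have "\<not> unf B x" using AB d_mono[of x A B] by (auto simp: unf_def)
    then show "\<Phi> B x = \<Phi> A x" using AB by (simp add: \<Phi>_def)
  qed
  have ghost: "\<delta> / 4 * (\<Sum>x | x \<in> \<Omega> \<and> unf B x. w x)\<^sup>2 \<le> (\<Sum>x | x \<in> \<Omega> \<and> unf B x. \<Sum>y | y \<in> \<Omega> \<and> unf B y.
         w x * w y * (\<Sum>e\<in>probes x - B. \<Phi> (insert e B) y - \<Phi> B y))" if B: "A0 \<subseteq> B" "B \<subseteq> I" for B
  proof -
    define X where "X = {x \<in> \<Omega>. unf B x}"
    have X: "x \<in> \<Omega>" "\<delta> * T < d B x" if "x \<in> X" for x using that by (auto simp: X_def unf_def)
    have finX: "finite X" using fin by (simp add: X_def)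
    have finI: "finite (probes x - B)" for x using probes(1) fin(3) by (meson finite_Diff finite_subset)
    obtain \<omega>0 where \<omega>0: "\<omega>0 \<in> \<Omega>" using W by (metis equals0I less_irrefl sum.empty)
    define g where "g = (\<lambda>a y. (real (f (insert a (y ` B))) - real (f (y ` B))) / d B y)"
    \<comment> \<open>Whether the policy probes \<open>e\<close> does not depend on the outcome of \<open>e\<close>, so the outcomes of \<open>e\<close>
      in two independent realizations may be exchanged.\<close>
    have swap: "(\<Sum>x\<in>X. \<Sum>y\<in>X. w x * w y * (if e \<in> probes x then g (x e) y else 0)) =
        (\<Sum>x\<in>X. \<Sum>y\<in>X. w x * w y * (if e \<in> probes x then g (y e) y else 0))" if e: "e \<in> I - B" for e
    proof -
      define sw where "sw = (\<lambda>z :: (nat \<Rightarrow> 'a) \<times> (nat \<Rightarrow> 'a). (fun_upd (fst z) e (snd z e), fun_upd (snd z) e (fst z e)))"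
      have im: "fun_upd x e a ` B = x ` B" for x and a :: 'a using e by (intro image_cong) auto
      have dupd: "d B (fun_upd x e a) = d B x" for x a unfolding d_def im ..
      have gupd: "g a (fun_upd y e b) = g a y" for a b y unfolding g_def im dupd ..
      \<comment> \<open>As \<open>e\<close> lies outside \<open>B\<close>, the exchange alters
        neither what is shown on \<open>B\<close> nor whether the realization is unfinished, so it
        is an involution of \<open>X \<times> X\<close>.\<close>
      have swX: "fun_upd x e (y e) \<in> X" if "x \<in> X" "y \<in> X" for x y
        using that exch(1)[of x y e] e by (simp add: X_def unf_def dupd)
      have sw_in: "sw z \<in> X \<times> X" if "z \<in> X \<times> X" for z
        using that swX by (simp add: sw_def mem_Times_iff)
      have sw_sw: "sw (sw z) = z" for z by (simp add: sw_def)
      have sw_eq: "w (fst (sw z)) * w (snd (sw z)) * (if e \<in> probes (fst (sw z)) then g (snd (sw z) e) (snd (sw z)) else 0)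
          = w (fst z) * w (snd z) * (if e \<in> probes (fst z) then g (fst z e) (snd z) else 0)" if "z \<in> X \<times> X" for z
        using exch(2)[of "fst z" "snd z" e] that e X(1)
        by (simp add: sw_def mem_Times_iff gupd decision_path_resample[OF probes(2)])
      have "(\<Sum>z\<in>X \<times> X. w (fst z) * w (snd z) * (if e \<in> probes (fst z) then g (fst z e) (snd z) else 0)) =
        (\<Sum>z\<in>X \<times> X. w (fst z) * w (snd z) * (if e \<in> probes (fst z) then g (snd z e) (snd z) else 0))"
        by (rule sum.reindex_bij_witness[of _ sw sw]) (rule sw_sw | erule sw_in | erule sw_eq)+
      then show ?thesis unfolding sum.cartesian_product split_def .
    qed
    have by_item: "(\<Sum>x\<in>X. \<Sum>y\<in>X. w x * w y * (\<Sum>e\<in>probes x - B. h x y e)) =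
        (\<Sum>e\<in>I - B. \<Sum>x\<in>X. \<Sum>y\<in>X. w x * w y * (if e \<in> probes x then h x y e else 0))"
      for h :: "_ \<Rightarrow> _ \<Rightarrow> _ \<Rightarrow> real"
    proof -
      have "(\<Sum>e\<in>probes x - B. h x y e) = (\<Sum>e\<in>I - B. if e \<in> probes x then h x y e else 0)" for x y
        using fin(3) probes(1)[of x] by (intro sum.mono_neutral_cong_left) auto
      then have "(\<Sum>x\<in>X. \<Sum>y\<in>X. w x * w y * (\<Sum>e\<in>probes x - B. h x y e)) =
          (\<Sum>x\<in>X. \<Sum>y\<in>X. \<Sum>e\<in>I - B. w x * w y * (if e \<in> probes x then h x y e else 0))"
        by (simp add: sum_distrib_left)
      also have "\<dots> = (\<Sum>x\<in>X. \<Sum>e\<in>I - B. \<Sum>y\<in>X. w x * w y * (if e \<in> probes x then h x y e else 0))"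
        by (intro sum.cong refl sum.swap)
      also have "\<dots> = (\<Sum>e\<in>I - B. \<Sum>x\<in>X. \<Sum>y\<in>X. w x * w y * (if e \<in> probes x then h x y e else 0))"
        by (rule sum.swap)
      finally show ?thesis .
    qed
    \<comment> \<open>All realizations agree on \<open>A0\<close>, so its image under a single
      \<open>\<omega>0\<close> serves as the common subset \<open>R\<close>, and its deficit is at
      most \<open>T\<close>.\<close>
    have "\<delta> / 4 * (sum w X)\<^sup>2 = \<delta> * T / (4 * T) * (sum w X)\<^sup>2" using T by simp
    also have "\<dots> \<le> (\<Sum>x\<in>X. \<Sum>y\<in>X. w x * w y * ((real (f (y ` B \<union> x ` (probes x - B))) - real (f (y ` B)))
          / (real (f U) - real (f (y ` B)))))"
    proof (rule independent_copy_gain[OF ms fin(1) finX, where R="\<omega>0 ` A0"])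
      fix x assume x: "x \<in> X"
      then have xO: "x \<in> \<Omega>" by (simp add: X)
      show "x ` B \<subseteq> U" "x ` (probes x - B) \<subseteq> U"
        using imU[OF xO] B probes(1)[of x] by blast+
      have "f (x ` probes x) \<le> f (x ` B \<union> x ` (probes x - B))" "f (x ` B \<union> x ` (probes x - B)) \<le> f U"
        using \<open>x ` B \<subseteq> U\<close> \<open>x ` (probes x - B) \<subseteq> U\<close>
        by (intro monotone_submodular_mono[OF ms]; auto)+
      then show "f (x ` B \<union> x ` (probes x - B)) = f U" using cov[OF xO] by simp
      show "\<omega>0 ` A0 \<subseteq> x ` B" using A0(2)[OF \<omega>0 xO] B by (auto simp: image_iff)
      show "\<delta> * T \<le> real (f U) - real (f (x ` B))" using X(2)[OF x] by (simp add: d_def)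
    qed (use w X dT T \<omega>0 imU[OF \<omega>0 A0(1)] in auto)
    also have "\<dots> \<le> (\<Sum>x\<in>X. \<Sum>y\<in>X. w x * w y * (\<Sum>e\<in>probes x - B. g (x e) y))"
    proof (intro sum_mono mult_left_mono)
      fix x y assume x: "x \<in> X" and y: "y \<in> X"
      have "real (f (y ` B \<union> x ` (probes x - B))) - real (f (y ` B))
          \<le> (\<Sum>e\<in>probes x - B. real (f (insert (x e) (y ` B))) - real (f (y ` B)))"
        using imU[OF X(1)[OF y] B(2)] imU[OF X(1)[OF x], of "probes x - B"] probes(1)[of x] finI
        by (intro monotone_submodular_sum_marginals[OF ms]) auto
      then show "(real (f (y ` B \<union> x ` (probes x - B))) - real (f (y ` B))) / (real (f U) - real (f (y ` B)))
          \<le> (\<Sum>e\<in>probes x - B. g (x e) y)"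
        unfolding g_def d_def sum_divide_distrib[symmetric]
        using d_nonneg[OF X(1)[OF y] B(2)] by (intro divide_right_mono) (auto simp: d_def)
    qed (use w X in auto)
    also have "\<dots> = (\<Sum>e\<in>I - B. \<Sum>x\<in>X. \<Sum>y\<in>X. w x * w y * (if e \<in> probes x then g (x e) y else 0))"
      by (rule by_item)
    also have "\<dots> = (\<Sum>e\<in>I - B. \<Sum>x\<in>X. \<Sum>y\<in>X. w x * w y * (if e \<in> probes x then g (y e) y else 0))"
      by (rule sum.cong[OF refl swap])
    also have "\<dots> = (\<Sum>x\<in>X. \<Sum>y\<in>X. w x * w y * (\<Sum>e\<in>probes x - B. g (y e) y))"
      by (rule by_item[symmetric])
    also have "\<dots> \<le> (\<Sum>x\<in>X. \<Sum>y\<in>X. w x * w y * (\<Sum>e\<in>probes x - B. \<Phi> (insert e B) y - \<Phi> B y))"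
    proof (intro sum_mono mult_left_mono)
      fix x y e assume "x \<in> X" "y \<in> X" "e \<in> probes x - B"
      then show "g (y e) y \<le> \<Phi> (insert e B) y - \<Phi> B y"
        using gain[of y B e] B probes(1)[of x] by (auto simp: g_def X_def d_def)
    qed (use w X in auto)
    finally show ?thesis
      by (simp add: X_def)
  qed
  have probesI: "probes x \<subseteq> I" if "x \<in> \<Omega>" for x by (rule probes(1))
  have "\<delta> / 4 > 0" using delta by simp
  interpret probing_round \<Omega> w I c probes \<Phi> unf L "\<delta> / 4" A0
    using fin(2,3) w c probesI A0(1) \<open>\<delta> / 4 > 0\<close> bounds step finished ghost by (rule probing_round.intro)
  obtain B where B: "A0 \<subseteq> B" "B \<subseteq> I" "unf_mass B \<le> \<eta> * sum w \<Omega>"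
    "\<delta> / 4 * \<eta> * sum c (B - A0) * sum w \<Omega> \<le> 8 * L * (\<Sum>\<omega>\<in>\<Omega>. w \<omega> * sum c (probes \<omega>))"
    using one_round[OF W eta] by blast
  have "sum c (B - A0) * sum w \<Omega> \<le> 32 * L / (\<delta> * \<eta>) * (\<Sum>\<omega>\<in>\<Omega>. w \<omega> * sum c (probes \<omega>))"
    using B(4) delta eta by (simp add: field_simps)
  then show ?thesis using B by (intro exI[of _ B]) (auto simp: unf_def d_def L_def not_le)
qed

section \<open>One round for correlated scenarios\<close>

text \<open>Outcomes of correlated items cannot be exchanged, so a copy is used only when it lies in
  the same class, i.e. agrees with the true realization on \<open>B\<close>. An unfinished class has
  more than \<open>\<delta> * T\<close> members out of at most \<open>T\<close>, so there are at
  most \<open>1 / \<delta>\<close> such classes, and two independent draws share one often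
  enough.\<close>

lemma scenario_round:
  fixes f :: "'a set \<Rightarrow> nat" and \<Omega> :: "(nat \<Rightarrow> 'a) set"
  assumes ms: "monotone_submodular U f" and fin: "finite \<Omega>" "finite I"
    and w: "\<And>\<omega>. \<omega> \<in> \<Omega> \<Longrightarrow> w \<omega> \<ge> 0" and c: "\<And>i. i \<in> I \<Longrightarrow> c i > 0"
    and probes: "\<And>\<omega>. probes \<omega> \<subseteq> I" "decision_path probes"
    and cov: "\<And>\<omega>. \<omega> \<in> \<Omega> \<Longrightarrow> f (\<omega> ` probes \<omega>) = f U"
    and range: "\<And>\<omega> i. \<omega> \<in> \<Omega> \<Longrightarrow> i \<in> I \<Longrightarrow> \<omega> i \<in> U"
    and A0: "A0 \<subseteq> I" and delta: "0 < \<delta>" "\<delta> \<le> 1" and T: "0 < T" "real (card \<Omega>) \<le> T"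
    and W: "sum w \<Omega> > 0" and eta: "\<eta> > 0"
  shows "\<exists>B. A0 \<subseteq> B \<and> B \<subseteq> I \<and>
    sum c (B - A0) * sum w \<Omega>
      \<le> 16 * (1 + log 2 (1 / \<delta>) + ln (real (f U))) / (\<delta> * \<eta>) * (\<Sum>\<omega>\<in>\<Omega>. w \<omega> * sum c (probes \<omega>)) \<and>
    sum w {\<omega>\<in>\<Omega>. \<not> (real (card {\<omega>'\<in>\<Omega>. \<forall>i\<in>B. \<omega>' i = \<omega> i}) \<le> \<delta> * T \<or> f (\<omega> ` B) = f U)} \<le> \<eta> * sum w \<Omega>"
proof -
  define cl where "cl = (\<lambda>B \<omega>. {\<omega>'\<in>\<Omega>. \<forall>i\<in>B. \<omega>' i = \<omega> i})"
  define h where "h = (\<lambda>B \<omega>. real (card (cl B \<omega>)))"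
  define d where "d = (\<lambda>(B :: nat set) (\<omega> :: nat \<Rightarrow> 'a). real (f U) - real (f (\<omega> ` B)))"
  define unf where "unf = (\<lambda>B \<omega>. \<delta> * T < h B \<omega> \<and> f (\<omega> ` B) \<noteq> f U)"
  define L where "L = 1 + log 2 (1 / \<delta>) + ln (real (f U))"
  \<comment> \<open>Base 2 makes halving a class worth exactly 1; the natural logarithm dominates
    the relative drop of the deficit. \<open>L\<close> exceeds the maximum of the sum by 1, so
    finishing also earns at least 1.\<close>
  define \<Phi> where "\<Phi> = (\<lambda>B \<omega>. if unf B \<omega> then log 2 (T / h B \<omega>) + ln (real (f U) / d B \<omega>) else L)"
  have dT: "\<delta> * T > 0" using delta T by simp
  \<comment> \<open>This includes \<open>f U = 0\<close>, where \<open>ln 0 = 0\<close>.\<close>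
  have lnU: "ln (real (f U)) \<ge> 0" by (cases "f U") auto
  have L: "L \<ge> 1" using delta lnU by (simp add: L_def)
  have imU: "\<omega> ` B \<subseteq> U" if "\<omega> \<in> \<Omega>" "B \<subseteq> I" for \<omega> B using range that by auto
  have d_mono: "d B' \<omega> \<le> d B \<omega>" if "\<omega> \<in> \<Omega>" "B \<subseteq> B'" "B' \<subseteq> I" for \<omega> B B'
    using monotone_submodular_mono[OF ms image_mono[OF that(2)] imU[OF that(1,3)]] by (simp add: d_def)
  have d_ins: "d (insert e B) \<omega> \<le> d B \<omega>" if "\<omega> \<in> \<Omega>" "B \<subseteq> I" "e \<in> I" for \<omega> B e
    using that by (intro d_mono) auto
  have d_nonneg: "0 \<le> d B \<omega>" if "\<omega> \<in> \<Omega>" "B \<subseteq> I" for \<omega> B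
    using monotone_submodular_mono[OF ms imU[OF that]] by (simp add: d_def)
  have d_unf: "1 \<le> d B \<omega>" "d B \<omega> \<le> real (f U)" if "\<omega> \<in> \<Omega>" "B \<subseteq> I" "f (\<omega> ` B) \<noteq> f U" for \<omega> B
    using d_nonneg[OF that(1,2)] that(3) by (auto simp: d_def)
  have fincl: "finite (cl B \<omega>)" for B \<omega> using fin by (simp add: cl_def)
  have h_mono: "h B' \<omega> \<le> h B \<omega>" if "B \<subseteq> B'" for B B' \<omega>
    using that fincl by (auto simp: h_def cl_def intro!: card_mono)
  have h_le: "h B \<omega> \<le> T" for B \<omega>
    using T(2) card_mono[OF fin(1), of "cl B \<omega>"] by (auto simp: h_def cl_def)
  have unf_mono: "unf A \<omega>" if "unf B \<omega>" "A \<subseteq> B" "B \<subseteq> I" "\<omega> \<in> \<Omega>" for A B \<omega>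
    using that h_mono[OF that(2), of \<omega>] d_mono[of \<omega> A B] d_nonneg[of \<omega> B] d_unf(1)[of \<omega> B]
    by (auto simp: unf_def d_def)
  have unfD: "h B \<omega> > 0" "1 \<le> d B \<omega>" "d B \<omega> \<le> real (f U)" "log 2 (T / h B \<omega>) \<le> log 2 (1 / \<delta>)"
    "0 \<le> log 2 (T / h B \<omega>)" "ln (real (f U) / d B \<omega>) \<le> ln (real (f U))" "0 \<le> ln (real (f U) / d B \<omega>)"
    if "unf B \<omega>" "\<omega> \<in> \<Omega>" "B \<subseteq> I" for B \<omega>
  proof -
    have hd: "\<delta> * T < h B \<omega>" using that by (simp add: unf_def)
    then show hp: "h B \<omega> > 0" using dT by linarith
    show d1: "1 \<le> d B \<omega>" and d2: "d B \<omega> \<le> real (f U)" using that d_unf by (auto simp: unf_def)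
    show "log 2 (T / h B \<omega>) \<le> log 2 (1 / \<delta>)"
      using hp hd delta T by (subst log_le_cancel_iff) (auto simp: field_simps)
    show "0 \<le> log 2 (T / h B \<omega>)" using hp h_le[of B \<omega>] T by (subst zero_le_log_cancel_iff) (auto simp: field_simps)
    show "ln (real (f U) / d B \<omega>) \<le> ln (real (f U))" using d1 d2 by (subst ln_div) auto
    show "0 \<le> ln (real (f U) / d B \<omega>)" using d1 d2 by simp
  qed
  have gain_gt: "\<Phi> (insert e B) \<omega> - \<Phi> B \<omega> \<ge> 1" if "unf B \<omega>" "\<not> unf (insert e B) \<omega>" "\<omega> \<in> \<Omega>" "B \<subseteq> I" for e B \<omega>
    using that unfD(4,6)[OF that(1,3,4)] by (simp add: \<Phi>_def L_def)
  have diff: "\<Phi> (insert e B) \<omega> - \<Phi> B \<omega> = log 2 (h B \<omega> / h (insert e B) \<omega>) + ln (d B \<omega> / d (insert e B) \<omega>)"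
    if "unf (insert e B) \<omega>" "unf B \<omega>" "\<omega> \<in> \<Omega>" "B \<subseteq> I" "e \<in> I" for e B \<omega>
    using that unfD(1-3)[of B \<omega>] unfD(1-3)[of "insert e B" \<omega>] T
    by (simp add: \<Phi>_def ln_div log_divide)
  have gain_cover: "(d B \<omega> - d (insert e B) \<omega>) / d B \<omega> \<le> \<Phi> (insert e B) \<omega> - \<Phi> B \<omega>"
    if *: "\<omega> \<in> \<Omega>" "B \<subseteq> I" "e \<in> I" "unf B \<omega>" for B e \<omega>
  proof (cases "unf (insert e B) \<omega>")
    case True
    have h: "h (insert e B) \<omega> > 0" "d (insert e B) \<omega> \<ge> 1" "h B \<omega> > 0" "d B \<omega> \<ge> 1"
      using unfD(1,2)[OF True] unfD(1,2)[OF *(4)] * by auto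
    have "0 \<le> log 2 (h B \<omega> / h (insert e B) \<omega>)"
      using h h_mono[of B "insert e B" \<omega>] by (subst zero_le_log_cancel_iff) auto
    moreover have "ln (d (insert e B) \<omega> / d B \<omega>) \<le> d (insert e B) \<omega> / d B \<omega> - 1"
      using h by (intro ln_le_minus_one) simp
    then have "(d B \<omega> - d (insert e B) \<omega>) / d B \<omega> \<le> ln (d B \<omega> / d (insert e B) \<omega>)"
      using h by (simp add: ln_div diff_divide_distrib)
    ultimately show ?thesis using diff[OF True *(4,1,2,3)] by linarith
  next
    case False
    have "(d B \<omega> - d (insert e B) \<omega>) / d B \<omega> \<le> 1"
      using unfD(2)[OF *(4,1,2)] d_nonneg[of \<omega> "insert e B"] * by auto
    then show ?thesis using gain_gt[OF *(4) False *(1,2)] by linarith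
  qed
  have gain_half: "1 \<le> \<Phi> (insert e B) \<omega> - \<Phi> B \<omega>"
    if *: "\<omega> \<in> \<Omega>" "B \<subseteq> I" "e \<in> I" "unf B \<omega>" "2 * h (insert e B) \<omega> \<le> h B \<omega>" for B e \<omega>
  proof (cases "unf (insert e B) \<omega>")
    case True
    have h: "h (insert e B) \<omega> > 0" "d (insert e B) \<omega> \<ge> 1" "h B \<omega> > 0" "d B \<omega> \<ge> 1"
      using unfD(1,2)[OF True] unfD(1,2)[OF *(4)] * by auto
    have "log 2 2 \<le> log 2 (h B \<omega> / h (insert e B) \<omega>)"
      using h *(5) by (subst log_le_cancel_iff) (auto simp: field_simps)
    moreover have "0 \<le> ln (d B \<omega> / d (insert e B) \<omega>)"
      using h d_ins[of \<omega> B e] * by auto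
    ultimately show ?thesis using diff[OF True *(4,1,2,3)] by simp
  qed (use gain_gt * in blast)
  have step: "\<Phi> B \<omega> \<le> \<Phi> (insert e B) \<omega>" if "\<omega> \<in> \<Omega>" "B \<subseteq> I" "e \<in> I" for B e \<omega>
  proof (cases "unf B \<omega>")
    case True
    have "0 \<le> (d B \<omega> - d (insert e B) \<omega>) / d B \<omega>"
      using d_ins[of \<omega> B e] d_nonneg[of \<omega> B] that by auto
    then show ?thesis using gain_cover[OF that True] by linarith
  next
    case False
    then have "\<not> unf (insert e B) \<omega>" using unf_mono[of "insert e B" \<omega> B] that by auto
    with False show ?thesis by (simp add: \<Phi>_def)
  qed
  have bounds: "0 \<le> \<Phi> B x \<and> \<Phi> B x \<le> L" if "A0 \<subseteq> B" "B \<subseteq> I" "x \<in> \<Omega>" for B x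
    proof (cases "unf B x")
      case True
      then show ?thesis using unfD(4-7)[OF True that(3,2)] by (simp add: \<Phi>_def L_def)
    qed (use L in \<open>simp add: \<Phi>_def\<close>)
  have finished: "\<Phi> B x = \<Phi> A x" if AB: "A0 \<subseteq> A" "A \<subseteq> B" "B \<subseteq> I" "x \<in> \<Omega>" "\<not> unf A x" for A B x
  proof -
    have "\<not> unf B x" using AB unf_mono[of B x A] by auto
    then show "\<Phi> B x = \<Phi> A x" using AB by (simp add: \<Phi>_def)
  qed
  have ghost: "\<delta> / 2 * (\<Sum>x | x \<in> \<Omega> \<and> unf B x. w x)\<^sup>2 \<le> (\<Sum>x | x \<in> \<Omega> \<and> unf B x. \<Sum>y | y \<in> \<Omega> \<and> unf B y.
         w x * w y * (\<Sum>e\<in>probes x - B. \<Phi> (insert e B) y - \<Phi> B y))" if B: "A0 \<subseteq> B" "B \<subseteq> I" for B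
  proof -
    define X where "X = {x \<in> \<Omega>. unf B x}"
    have X: "x \<in> \<Omega>" "unf B x" if "x \<in> X" for x using that by (auto simp: X_def)
    have finX: "finite X" using fin by (simp add: X_def)
    have finI: "finite (probes x - B)" for x using probes(1) fin(2) by (meson finite_Diff finite_subset)
    define \<gamma> where "\<gamma> = (\<lambda>x y. \<Sum>e\<in>probes x - B. \<Phi> (insert e B) y - \<Phi> B y)"
    have g0: "\<gamma> x y \<ge> 0" if "x \<in> X" "y \<in> X" for x y
      using that X(1) step B probes(1)[of x] by (auto simp: \<gamma>_def intro!: sum_nonneg)
    \<comment> \<open>Two realizations with the same observations either have the same run of the policy, which then
      covers \<open>f\<close>, or their runs part at an item that at least halves the class of one of them.\<close>
    have pair: "1 \<le> \<gamma> x y + \<gamma> y x" if x: "x \<in> X" and y: "y \<in> X" and eq: "cl B x = cl B y" for x y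
    proof -
      have same: "x i = y i" if "i \<in> B" for i
      proof -
        have "x \<in> cl B y" using eq X(1)[OF x] by (auto simp: cl_def)
        then show ?thesis using that by (simp add: cl_def)
      qed
      from probes(2)[unfolded decision_path_def, rule_format, of x y] show ?thesis
      proof (elim disjE conjE bexE)
        assume eqp: "probes x = probes y" "\<forall>i\<in>probes x. x i = y i"
        have yO: "y \<in> \<Omega>" using X(1)[OF y] .
        have U: "y ` B \<subseteq> U" "y ` (probes x - B) \<subseteq> U" using imU[OF yO] B(2) probes(1)[of x] by blast+
        have "f (y ` probes y) \<le> f (y ` B \<union> y ` (probes x - B))"
          using U by (intro monotone_submodular_mono[OF ms]) (auto simp: eqp(1))
        then have "real (f U) - real (f (y ` B)) \<le> real (f (y ` B \<union> y ` (probes x - B))) - real (f (y ` B))"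
          using cov[OF yO] by simp
        also have "\<dots> \<le> (\<Sum>e\<in>probes x - B. real (f (insert (y e) (y ` B))) - real (f (y ` B)))"
          using U finI by (intro monotone_submodular_sum_marginals[OF ms])
        finally have "d B y / d B y \<le> (\<Sum>e\<in>probes x - B. real (f (insert (y e) (y ` B))) - real (f (y ` B))) / d B y"
          using d_nonneg[OF yO B(2)] by (intro divide_right_mono) (auto simp: d_def)
        also have "\<dots> \<le> \<gamma> x y"
          unfolding \<gamma>_def sum_divide_distrib
        proof (rule sum_mono)
          fix e assume "e \<in> probes x - B"
          then show "(real (f (insert (y e) (y ` B))) - real (f (y ` B))) / d B y \<le> \<Phi> (insert e B) y - \<Phi> B y"
            using gain_cover[OF yO B(2), of e] X(2)[OF y] probes(1)[of x] by (auto simp: d_def)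
        qed
        finally show ?thesis using unfD(2)[OF X(2,1)[OF y] B(2)] g0[OF y x] by simp
      next
        fix e assume e: "e \<in> probes x \<inter> probes y" "x e \<noteq> y e"
        have eB: "e \<in> I" "e \<notin> B" using e same probes(1)[of x] by auto
        have "h (insert e B) x + h (insert e B) y = real (card (cl (insert e B) x \<union> cl (insert e B) y))"
          unfolding h_def of_nat_add[symmetric]
          using e(2) by (subst card_Un_disjoint[OF fincl fincl]) (auto simp: cl_def)
        also have "\<dots> \<le> h B x"
          using fincl eq same by (auto simp: h_def cl_def intro!: card_mono)
        finally have "2 * h (insert e B) x \<le> h B x \<or> 2 * h (insert e B) y \<le> h B y"
          using eq by (auto simp: h_def)
        then have one: "1 \<le> \<Phi> (insert e B) x - \<Phi> B x \<or> 1 \<le> \<Phi> (insert e B) y - \<Phi> B y"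
          using gain_half[of x B e] gain_half[of y B e] X[OF x] X[OF y] B eB by blast
        have "\<Phi> (insert e B) z - \<Phi> B z \<le> \<gamma> z' z" if "z \<in> X" "z' \<in> X" "e \<in> probes z'" for z z'
          unfolding \<gamma>_def using that eB finI X(1) step[OF _ B(2)] probes(1)[of z']
          by (intro member_le_sum) auto
        then show ?thesis using one g0[OF x y] g0[OF y x] x y e(1) by (smt (verit) IntD1 IntD2)
      qed
    qed
    let ?S = "\<Sum>x\<in>X. \<Sum>y\<in>X. w x * w y * \<gamma> x y"
    have "2 * ?S = (\<Sum>x\<in>X. \<Sum>y\<in>X. w x * w y * (\<gamma> x y + \<gamma> y x))"
    proof -
      have "?S = (\<Sum>x\<in>X. \<Sum>y\<in>X. w x * w y * \<gamma> y x)"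
        by (subst sum.swap) (simp add: mult_ac)
      then show ?thesis by (simp add: distrib_left sum.distrib)
    qed
    \<comment> \<open>Pairs from different classes contribute nonnegative terms and are dropped;
      same-class pairs contribute at least their weight by \<open>pair\<close>.\<close>
    also have "\<dots> \<ge> (\<Sum>x\<in>X. \<Sum>y\<in>X. if cl B y = cl B x then w x * w y else 0)"
    proof (intro sum_mono)
      fix x y assume xy: "x \<in> X" "y \<in> X"
      have "w x * w y \<ge> 0" using w X xy by simp
      then show "(if cl B y = cl B x then w x * w y else 0) \<le> w x * w y * (\<gamma> x y + \<gamma> y x)"
        using pair[OF xy] g0[OF xy] g0[OF xy(2,1)] by (simp add: mult_le_cancel_left1)
    qed
    finally have S2: "(\<Sum>x\<in>X. \<Sum>y\<in>X. if cl B y = cl B x then w x * w y else 0) \<le> 2 * ?S" .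
    define \<C> where "\<C> = cl B ` X"
    define p where "p = (\<lambda>K. sum w {x\<in>X. cl B x = K})"
    have finC: "finite \<C>" using finX by (simp add: \<C>_def)
    have tot: "sum w X = (\<Sum>K\<in>\<C>. p K)"
      unfolding p_def \<C>_def using finX by (intro sum.group[symmetric]) auto
    have "(\<Sum>x\<in>X. \<Sum>y\<in>X. if cl B y = cl B x then w x * w y else 0) = (\<Sum>x\<in>X. w x * p (cl B x))"
      using finX by (simp add: p_def sum.inter_filter sum_distrib_left if_distrib cong: if_cong)
    also have "\<dots> = (\<Sum>K\<in>\<C>. \<Sum>x\<in>{x\<in>X. cl B x = K}. w x * p (cl B x))"
      unfolding \<C>_def using finX by (intro sum.group[symmetric]) auto
    also have "\<dots> = (\<Sum>K\<in>\<C>. (p K)\<^sup>2)"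
      by (intro sum.cong refl) (simp add: p_def power2_eq_square sum_distrib_right)
    finally have sq: "(\<Sum>K\<in>\<C>. (p K)\<^sup>2) \<le> 2 * ?S" using S2 by simp
    have "real (card \<C>) * (\<delta> * T) \<le> (\<Sum>K\<in>\<C>. real (card K))"
    proof (rule sum_bounded_below)
      fix K assume "K \<in> \<C>"
      then obtain x where "x \<in> X" "K = cl B x" by (auto simp: \<C>_def)
      then show "\<delta> * T \<le> real (card K)" using X(2)[of x] by (simp add: unf_def h_def)
    qed
    also have "\<dots> = real (card (\<Union>\<C>))"
    proof -
      have "cl B x \<inter> cl B y = {}" if "cl B x \<noteq> cl B y" for x y
      proof (rule ccontr)
        assume "cl B x \<inter> cl B y \<noteq> {}"
        then obtain z where "z \<in> cl B x" "z \<in> cl B y" by blast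
        then have "\<forall>i\<in>B. x i = y i" by (simp add: cl_def)
        then have "cl B x = cl B y" by (simp add: cl_def)
        with that show False ..
      qed
      then have "pairwise disjnt \<C>" by (auto simp: \<C>_def pairwise_def disjnt_def)
      then have "card (\<Union>\<C>) = sum card \<C>"
        by (rule card_Union_disjoint) (use fincl in \<open>auto simp: \<C>_def\<close>)
      then show ?thesis by simp
    qed
    also have "\<dots> \<le> T"
    proof -
      have "card (\<Union>\<C>) \<le> card \<Omega>" using fin(1) by (intro card_mono) (auto simp: \<C>_def cl_def)
      then show ?thesis using T(2) by linarith
    qed
    finally have cardC: "real (card \<C>) * \<delta> \<le> 1" using T by simp
    \<comment> \<open>Cauchy-Schwarz over the classes. The factor 2 in \<open>2 * ?S\<close>, from
      symmetrizing \<open>\<gamma>\<close>, is why \<open>\<kappa>\<close> is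
      \<open>\<delta> / 2\<close>.\<close>
    have "\<delta> * (sum w X)\<^sup>2 \<le> \<delta> * ((\<Sum>K\<in>\<C>. (p K)\<^sup>2) * real (card \<C>))"
      using sum_squared_le_sum_of_squares[of p \<C>] delta unfolding tot by (intro mult_left_mono) auto
    also have "\<dots> = (\<Sum>K\<in>\<C>. (p K)\<^sup>2) * (real (card \<C>) * \<delta>)" by simp
    also have "\<dots> \<le> (\<Sum>K\<in>\<C>. (p K)\<^sup>2) * 1"
      using cardC by (intro mult_left_mono sum_nonneg) auto
    also note sq
    finally have "\<delta> / 2 * (sum w X)\<^sup>2 \<le> ?S" by simp
    then show ?thesis
      by (simp add: X_def \<gamma>_def)
  qed
  have step': "\<Phi> B x \<le> \<Phi> (insert e B) x" if "A0 \<subseteq> B" "B \<subseteq> I" "e \<in> I" "x \<in> \<Omega>" for B e x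
    using that by (intro step)
  have probesI: "probes x \<subseteq> I" if "x \<in> \<Omega>" for x by (rule probes(1))
  have "\<delta> / 2 > 0" using delta by simp
  interpret probing_round \<Omega> w I c probes \<Phi> unf L "\<delta> / 2" A0
    using fin(1,2) w c probesI A0 \<open>\<delta> / 2 > 0\<close> bounds step' finished ghost by (rule probing_round.intro)
  obtain B where B: "A0 \<subseteq> B" "B \<subseteq> I" "unf_mass B \<le> \<eta> * sum w \<Omega>"
    "\<delta> / 2 * \<eta> * sum c (B - A0) * sum w \<Omega> \<le> 8 * L * (\<Sum>\<omega>\<in>\<Omega>. w \<omega> * sum c (probes \<omega>))"
    using one_round[OF W eta] by blast
  have "sum c (B - A0) * sum w \<Omega> \<le> 16 * L / (\<delta> * \<eta>) * (\<Sum>\<omega>\<in>\<Omega>. w \<omega> * sum c (probes \<omega>))"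
    using B(4) delta eta by (simp add: field_simps)
  then show ?thesis using B by (intro exI[of _ B]) (auto simp: unf_def h_def cl_def L_def not_le)
qed

section \<open>Round-adaptive policies and the final constants\<close>

text \<open>\<open>compose_rounds\<close> with weights \<open>pmf D\<close>, where \<open>v\<close>
  is the adaptive policy's cost share; its total becomes \<open>OPT\<close> for optimal
  \<open>probes\<close>.\<close>

lemma policy_from_rounds:
  fixes D :: "(nat \<Rightarrow> 'a) pmf" and G :: "nat \<Rightarrow> nat set \<Rightarrow> (nat \<Rightarrow> 'a) \<Rightarrow> bool"
  assumes fin: "finite (set_pmf D)" and c: "\<And>i. i < m \<Longrightarrow> c i > 0"
    and probes: "\<And>\<omega>. probes \<omega> \<subseteq> {..<m}"
    and M: "\<And>k. k < r \<Longrightarrow> M k \<ge> 0" and eta: "\<And>k. k < r \<Longrightarrow> \<eta> k \<ge> 0"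
    and G0: "\<And>\<omega>. \<omega> \<in> set_pmf D \<Longrightarrow> G 0 {} \<omega>"
    and Gcong: "\<And>k A \<omega> \<omega>'. G k A \<omega> \<Longrightarrow> observe \<omega> A = observe \<omega>' A \<Longrightarrow> G k A \<omega>'"
    and Gr: "\<And>A \<omega>. \<omega> \<in> set_pmf D \<Longrightarrow> A \<subseteq> {..<m} \<Longrightarrow> G r A \<omega> \<Longrightarrow> f (\<omega> ` A) = f U"
    and step: "\<And>k ob. k < r \<Longrightarrow> dom ob \<subseteq> {..<m} \<Longrightarrow> cyl (set_pmf D) ob \<noteq> {} \<Longrightarrow>
      (\<forall>\<omega>\<in>cyl (set_pmf D) ob. G k (dom ob) \<omega>) \<Longrightarrow>
      \<exists>B. dom ob \<subseteq> B \<and> B \<subseteq> {..<m} \<and>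
        sum c (B - dom ob) * sum (pmf D) (cyl (set_pmf D) ob)
          \<le> M k * (\<Sum>\<omega>\<in>cyl (set_pmf D) ob. pmf D \<omega> * sum c (probes \<omega>)) \<and>
        sum (pmf D) {\<omega>\<in>cyl (set_pmf D) ob. \<not> G (Suc k) B \<omega>} \<le> \<eta> k * sum (pmf D) (cyl (set_pmf D) ob)"
  shows "\<exists>\<sigma>. set_based_policy m \<sigma> \<and>
    measure_pmf.expectation D (rounds_cost c r \<sigma>)
      \<le> (\<Sum>k<r. M k) * (\<Sum>\<omega>\<in>set_pmf D. pmf D \<omega> * sum c (probes \<omega>)) \<and>
    rounds_cover_prob U f r \<sigma> D \<ge> 1 - (\<Sum>k<r. \<eta> k)"
proof -
  let ?\<Omega> = "set_pmf D"
  have v: "pmf D \<omega> * sum c (probes \<omega>) \<ge> 0" for \<omega>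
    using c probes[of \<omega>] by (intro mult_nonneg_nonneg sum_nonneg) (auto intro: less_imp_le)
  have "\<exists>\<sigma>. (\<forall>k ob. \<sigma> k ob \<subseteq> {..<m}) \<and>
    (\<Sum>\<omega>\<in>?\<Omega>. pmf D \<omega> * rounds_cost c r \<sigma> \<omega>) \<le> (\<Sum>k<r. M k) * (\<Sum>\<omega>\<in>?\<Omega>. pmf D \<omega> * sum c (probes \<omega>)) \<and>
    sum (pmf D) {\<omega>\<in>?\<Omega>. \<not> G r (dom (round_obs \<sigma> \<omega> r)) \<omega>} \<le> (\<Sum>k<r. \<eta> k) * sum (pmf D) ?\<Omega>"
    by (rule compose_rounds[where \<Omega>="?\<Omega>" and I="{..<m}" and w="pmf D" and G=G and c=c and M=M and \<eta>=\<eta>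
        and r=r and v="\<lambda>\<omega>. pmf D \<omega> * sum c (probes \<omega>)"];
        (fact fin finite_lessThan M eta G0 Gcong step | rule pmf_nonneg | rule v | blast))
  then obtain \<sigma> where s: "\<And>k ob. \<sigma> k ob \<subseteq> {..<m}"
    "(\<Sum>\<omega>\<in>?\<Omega>. pmf D \<omega> * rounds_cost c r \<sigma> \<omega>) \<le> (\<Sum>k<r. M k) * (\<Sum>\<omega>\<in>?\<Omega>. pmf D \<omega> * sum c (probes \<omega>))"
    "sum (pmf D) {\<omega>\<in>?\<Omega>. \<not> G r (dom (round_obs \<sigma> \<omega> r)) \<omega>} \<le> (\<Sum>k<r. \<eta> k) * sum (pmf D) ?\<Omega>"
    by blast
  have one: "sum (pmf D) ?\<Omega> = 1" using fin by (intro sum_pmf_eq_1) auto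
  have dom: "dom (round_obs \<sigma> \<omega> k) \<subseteq> {..<m}" for \<omega> k using s(1) by (induction k) auto
  have "measure_pmf.expectation D (rounds_cost c r \<sigma>) = (\<Sum>\<omega>\<in>?\<Omega>. pmf D \<omega> * rounds_cost c r \<sigma> \<omega>)"
    using fin by (subst integral_measure_pmf[of ?\<Omega>]) auto
  moreover have "rounds_cover_prob U f r \<sigma> D \<ge> 1 - (\<Sum>k<r. \<eta> k)"
  proof -
    let ?b = "\<lambda>\<omega>. \<not> G r (dom (round_obs \<sigma> \<omega> r)) \<omega>"
    have "?\<Omega> = {\<omega>\<in>?\<Omega>. ?b \<omega>} \<union> {\<omega>\<in>?\<Omega>. \<not> ?b \<omega>}" by auto
    then have "1 = sum (pmf D) ({\<omega>\<in>?\<Omega>. ?b \<omega>} \<union> {\<omega>\<in>?\<Omega>. \<not> ?b \<omega>})" using one by simp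
    also have "\<dots> = sum (pmf D) {\<omega>\<in>?\<Omega>. ?b \<omega>} + sum (pmf D) {\<omega>\<in>?\<Omega>. \<not> ?b \<omega>}"
      using fin by (intro sum.union_disjoint) auto
    also have "sum (pmf D) {\<omega>\<in>?\<Omega>. \<not> ?b \<omega>} = measure_pmf.prob D {\<omega>\<in>?\<Omega>. \<not> ?b \<omega>}"
      using fin by (subst measure_measure_pmf_finite) auto
    also have "\<dots> \<le> rounds_cover_prob U f r \<sigma> D"
      unfolding rounds_cover_prob_def using Gr[OF _ dom]
      by (intro measure_pmf.finite_measure_mono) auto
    finally show ?thesis using s(3) one by simp
  qed
  ultimately show ?thesis using s by (intro exI[of _ \<sigma>]) (auto simp: set_based_policy_def)
qed

text \<open>Only the two factors at \<open>e\<close> are affected, and they trade places.\<close>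

lemma Pi_pmf_exchange:
  fixes \<omega> \<omega>' :: "nat \<Rightarrow> 'a"
  assumes "finite A" "e \<in> A" "\<omega> \<in> set_pmf (Pi_pmf A dflt P)" "\<omega>' \<in> set_pmf (Pi_pmf A dflt P)"
  shows "pmf (Pi_pmf A dflt P) (fun_upd \<omega> e (\<omega>' e)) * pmf (Pi_pmf A dflt P) (fun_upd \<omega>' e (\<omega> e)) =
    pmf (Pi_pmf A dflt P) \<omega> * pmf (Pi_pmf A dflt P) \<omega>'"
proof -
  have dflt: "x i = dflt" if "x \<in> set_pmf (Pi_pmf A dflt P)" "i \<notin> A" for x i
    using that assms(1) set_Pi_pmf_subset[of A dflt P] by auto
  have pmf: "pmf (Pi_pmf A dflt P) x = pmf (P e) (x e) * (\<Prod>i\<in>A - {e}. pmf (P i) (x i))"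
    if "\<And>i. i \<notin> A \<Longrightarrow> x i = dflt" for x
    using that assms(1,2) by (simp add: pmf_Pi prod.remove[of A e])
  have "(\<Prod>i\<in>A - {e}. pmf (P i) (fun_upd x e a i)) = (\<Prod>i\<in>A - {e}. pmf (P i) (x i))" for x a
    by (intro prod.cong) auto
  then show ?thesis using dflt[OF assms(3)] dflt[OF assms(4)] assms(2) by (subst (1 2 3 4) pmf) auto
qed

text \<open>The 2 in the base brings the quantity down to \<open>1 / 2\<close> after
  \<open>n\<close> rounds, strictly below 1, which decides integer quantities; it costs at most a
  factor 2 in \<open>1 / \<delta>\<close>.\<close>

lemma root_scale:
  fixes x \<delta> :: real
  assumes x: "x \<ge> 1" and n: "n \<ge> 1" and delta: "\<delta> = (2 * x) powr (- 1 / real n)"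
  shows "0 < \<delta>" "\<delta> \<le> 1" "\<delta> ^ n * x = 1 / 2" "1 / \<delta> \<le> 2 * x powr (1 / real n)"
    "ln (1 / \<delta>) = (ln 2 + ln x) / real n"
proof -
  show d0: "0 < \<delta>" using x by (simp add: delta)
  have "(2 * x) powr (- 1 / real n) \<le> (2 * x) powr 0" using x n by (intro powr_mono) auto
  then show "\<delta> \<le> 1" using x by (simp add: delta)
  have "\<delta> ^ n = \<delta> powr real n" using d0 by (simp add: powr_realpow)
  also have "\<dots> = (2 * x) powr (- 1)" unfolding delta using n by (simp add: powr_powr)
  also have "\<dots> = 1 / (2 * x)" using x by (simp add: powr_minus_divide)
  finally show "\<delta> ^ n * x = 1 / 2" using x by simp
  have "2 powr (1 / real n) \<le> (2::real)" using powr_mono[of "1 / real n" 1 2] n by simp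
  then have "2 powr (1 / real n) * x powr (1 / real n) \<le> 2 * x powr (1 / real n)"
    by (intro mult_right_mono) auto
  then show "1 / \<delta> \<le> 2 * x powr (1 / real n)"
    using x by (simp add: delta powr_minus divide_inverse powr_mult)
  show "ln (1 / \<delta>) = (ln 2 + ln x) / real n"
    using x d0 by (simp add: delta ln_div ln_powr ln_mult)
qed

text \<open>A bare logarithm in the bound would vanish at \<open>f U = 1\<close>, where covering can
  still cost something; hence \<open>1 + ln\<close>.\<close>

lemma stochastic_cover:
  fixes U :: "'a set" and P :: "nat \<Rightarrow> 'a pmf"
  assumes inst: "cover_instance U f m c (Pi_pmf {..<m} undefined P)" and r: "r \<ge> 1" and eta: "\<eta> > 0"
  shows "\<exists>\<sigma>. set_based_policy m \<sigma> \<and>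
    measure_pmf.expectation (Pi_pmf {..<m} undefined P) (rounds_cost c r \<sigma>)
      \<le> 576 * (real r / \<eta>) * real (f U) powr (1 / real r) * (1 + ln (real (f U)))
          * OPT m c U f (Pi_pmf {..<m} undefined P) \<and>
    rounds_cover_prob U f r \<sigma> (Pi_pmf {..<m} undefined P) \<ge> 1 - \<eta>"
proof -
  define D where "D = Pi_pmf {..<m} undefined P"
  define \<Omega> where "\<Omega> = set_pmf D"
  have inst': "cover_instance U f m c D" using inst by (simp add: D_def)
  have finU: "finite U" and ms: "monotone_submodular U f" and c: "\<And>i. i < m \<Longrightarrow> c i > 0"
    and range: "\<And>\<omega> i. \<omega> \<in> \<Omega> \<Longrightarrow> i < m \<Longrightarrow> \<omega> i \<in> U"
    using inst' by (auto simp: cover_instance_def \<Omega>_def)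
  have "\<Omega> \<subseteq> PiE_dflt {..<m} undefined (\<lambda>_. U)"
    using range set_Pi_pmf_subset[of "{..<m}" undefined P] by (auto simp: PiE_dflt_def \<Omega>_def D_def)
  then have fin: "finite \<Omega>" by (rule finite_subset) (auto intro: finite_PiE_dflt finU)
  obtain probes where pr: "decision_path probes" "\<And>\<omega>. probes \<omega> \<subseteq> {..<m}"
    "\<And>\<omega>. \<omega> \<in> \<Omega> \<Longrightarrow> f (\<omega> ` probes \<omega>) = f U" "OPT m c U f D = (\<Sum>\<omega>\<in>\<Omega>. pmf D \<omega> * sum c (probes \<omega>))"
    using OPT_attained[OF fin[unfolded \<Omega>_def] inst'] unfolding \<Omega>_def by blast
  have OPT0: "OPT m c U f D \<ge> 0" unfolding pr(4)
  proof (intro sum_nonneg mult_nonneg_nonneg pmf_nonneg)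
    show "c i \<ge> 0" if "i \<in> probes \<omega>" for i \<omega> using that pr(2)[of \<omega>] c[of i] by force
  qed
  have exch: "pmf D (fun_upd \<omega> e (\<omega>' e)) * pmf D (fun_upd \<omega>' e (\<omega> e)) = pmf D \<omega> * pmf D \<omega>'"
    if "\<omega> \<in> \<Omega>" "\<omega>' \<in> \<Omega>" "e < m" for \<omega> \<omega>' e
    using Pi_pmf_exchange[of "{..<m}" e \<omega> undefined P \<omega>'] that by (simp add: D_def \<Omega>_def)
  have exch_in: "fun_upd \<omega> e (\<omega>' e) \<in> \<Omega>" if "\<omega> \<in> \<Omega>" "\<omega>' \<in> \<Omega>" "e < m" for \<omega> \<omega>' e
    \<comment> \<open>The product of the two masses is positive, so neither exchanged realization
      can have mass zero.\<close>
    using exch[OF that] that by (auto simp: \<Omega>_def set_pmf_iff)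
  show ?thesis
  proof (cases "f U = 0")
    case True
    \<comment> \<open>Here the bound itself is zero, as \<open>0 powr (1 / r) = 0\<close>, so the
      policy must probe nothing; the empty set covers.\<close>
    have "f {} \<le> f U" by (rule monotone_submodular_mono[OF ms]) auto
    moreover have "dom (round_obs (\<lambda>_ _. {}) \<omega> k) = {}" for \<omega> :: "nat \<Rightarrow> 'a" and k
      by (induction k) auto
    moreover have "rounds_cost c r (\<lambda>_ _. {}) = (\<lambda>\<omega> :: nat \<Rightarrow> 'a. 0)" by (simp add: rounds_cost_def fun_eq_iff)
    ultimately show ?thesis using True eta
      by (intro exI[of _ "\<lambda>_ _. {}"])
        (simp add: set_based_policy_def rounds_cover_prob_def del: dom_eq_empty_conv)
  next
    case False
    define Q where "Q = real (f U)"
    have Q: "Q \<ge> 1" using False by (simp add: Q_def)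
    have lnQ: "ln Q \<ge> 0" using Q by simp
    define t where "t = nat \<lceil>ln Q\<rceil> + 1"
    have t: "ln Q \<le> real t" "real t \<le> ln Q + 2" using lnQ unfolding t_def by linarith+
    \<comment> \<open>More than about \<open>ln Q\<close> rounds would only add cost, so the rounds from \<open>r'\<close> on stay empty.\<close>
    define r' where "r' = min r t"
    have r': "r' \<ge> 1" "r' \<le> r" using r by (auto simp: r'_def t_def)
    define \<delta> where "\<delta> = (2 * Q) powr (- 1 / real r')"
    note d = root_scale[OF Q r'(1) \<delta>_def]
    define M where "M = 32 * (1 + ln (1 / \<delta>)) / (\<delta> * (\<eta> / real r'))"
    have M: "M \<ge> 0" using d(1,2) eta r' by (simp add: M_def)
    \<comment> \<open>\<open>min k r'\<close> freezes the target after round \<open>r'\<close>, so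
      that the empty rounds keep the schedule without any failure.\<close>
    define G where "G = (\<lambda>k A (\<omega> :: nat \<Rightarrow> 'a). real (f U) - real (f (\<omega> ` A)) \<le> \<delta> ^ min k r' * Q)"
    have "\<exists>\<sigma>. set_based_policy m \<sigma> \<and>
      measure_pmf.expectation D (rounds_cost c r \<sigma>)
        \<le> (\<Sum>k<r. if k < r' then M else 0) * (\<Sum>\<omega>\<in>set_pmf D. pmf D \<omega> * sum c (probes \<omega>)) \<and>
      rounds_cover_prob U f r \<sigma> D \<ge> 1 - (\<Sum>k<r. if k < r' then \<eta> / real r' else 0)"
    proof (rule policy_from_rounds[where G=G])
      show "finite (set_pmf D)" using fin by (simp add: \<Omega>_def)
      show "G 0 {} \<omega>" for \<omega> by (simp add: G_def Q_def)
      show "G k A \<omega>'" if "G k A \<omega>" "observe \<omega> A = observe \<omega>' A" for k A \<omega> \<omega>'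
      proof -
        have "\<omega> ` A = \<omega>' ` A" using that(2) by (intro image_cong) (auto simp: observe_eq_iff)
        then show ?thesis using that(1) by (simp add: G_def)
      qed
      show "f (\<omega> ` A) = f U" if "\<omega> \<in> set_pmf D" "A \<subseteq> {..<m}" "G r A \<omega>" for A \<omega>
      proof -
        have "\<omega> ` A \<subseteq> U" using that(1,2) range by (auto simp: \<Omega>_def)
        then have "f (\<omega> ` A) \<le> f U" by (rule monotone_submodular_mono[OF ms]) auto
        moreover have "real (f U) - real (f (\<omega> ` A)) \<le> 1 / 2"
          using that(3) d(3) min_absorb2[OF r'(2)] by (simp add: G_def)
        ultimately show ?thesis by linarith
      qed
    next
      fix k ob assume k: "k < r" and ob: "dom ob \<subseteq> {..<m}" "cyl (set_pmf D) ob \<noteq> {}"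
        and Gk: "\<forall>\<omega>\<in>cyl (set_pmf D) ob. G k (dom ob) \<omega>"
      let ?C = "cyl (set_pmf D) ob"
      have C: "\<omega> \<in> \<Omega>" "\<And>i. i \<in> dom ob \<Longrightarrow> ob i = Some (\<omega> i)" if "\<omega> \<in> ?C" for \<omega>
        using that by (auto simp: cyl_def \<Omega>_def observe_def fun_eq_iff split: if_splits)
      have Ceq: "\<omega> \<in> ?C \<longleftrightarrow> \<omega> \<in> \<Omega> \<and> (\<forall>i\<in>dom ob. ob i = Some (\<omega> i))" for \<omega>
        by (auto simp: cyl_def \<Omega>_def observe_def fun_eq_iff dom_def)
      show "\<exists>B. dom ob \<subseteq> B \<and> B \<subseteq> {..<m} \<and>
        sum c (B - dom ob) * sum (pmf D) ?C
          \<le> (if k < r' then M else 0) * (\<Sum>\<omega>\<in>?C. pmf D \<omega> * sum c (probes \<omega>)) \<and>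
        sum (pmf D) {\<omega>\<in>?C. \<not> G (Suc k) B \<omega>} \<le> (if k < r' then \<eta> / real r' else 0) * sum (pmf D) ?C"
      proof (cases "k < r'")
        case True
        have finC: "finite ?C" using fin by (auto simp: cyl_def \<Omega>_def)
        have "\<exists>B. dom ob \<subseteq> B \<and> B \<subseteq> {..<m} \<and>
          sum c (B - dom ob) * sum (pmf D) ?C
            \<le> 32 * (1 + ln (1 / \<delta>)) / (\<delta> * (\<eta> / real r')) * (\<Sum>\<omega>\<in>?C. pmf D \<omega> * sum c (probes \<omega>)) \<and>
          sum (pmf D) {\<omega>\<in>?C. \<not> real (f U) - real (f (\<omega> ` B)) \<le> \<delta> * (\<delta> ^ k * Q)}
            \<le> \<eta> / real r' * sum (pmf D) ?C"
        proof (rule product_round[OF ms finU finC finite_lessThan])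
          show "0 < sum (pmf D) ?C"
            using finC ob(2) C(1) by (intro sum_pos) (auto simp: \<Omega>_def pmf_positive)
          show "real (f U) - real (f (\<omega> ` dom ob)) \<le> \<delta> ^ k * Q" if "\<omega> \<in> ?C" for \<omega>
            using Gk that True by (simp add: G_def min_def)
          show "fun_upd \<omega> e (\<omega>' e) \<in> ?C" if "\<omega> \<in> ?C" "\<omega>' \<in> ?C" "e \<in> {..<m}" for \<omega> \<omega>' e
            using that exch_in[of \<omega> \<omega>' e] unfolding Ceq by auto
          show "\<omega> i = \<omega>' i" if "\<omega> \<in> ?C" "\<omega>' \<in> ?C" "i \<in> dom ob" for \<omega> \<omega>' i
            using C(2)[OF that(1,3)] C(2)[OF that(2,3)] by simp
        qed (use c pr C(1) range exch ob(1) d(1,2) Q eta r' in auto)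
        then show ?thesis using True by (simp add: M_def G_def min_def mult.assoc)
      next
        case False
        then have "{\<omega>\<in>?C. \<not> G (Suc k) (dom ob) \<omega>} = {}" using Gk by (auto simp: G_def min_absorb2)
        then show ?thesis using False ob(1)
          by (intro exI[of _ "dom ob"]) (simp del: Collect_empty_eq)
      qed
    qed (use c pr M eta in auto)
    then obtain \<sigma> where s: "set_based_policy m \<sigma>"
      "measure_pmf.expectation D (rounds_cost c r \<sigma>) \<le> (\<Sum>k<r. if k < r' then M else 0) * OPT m c U f D"
      "rounds_cover_prob U f r \<sigma> D \<ge> 1 - (\<Sum>k<r. if k < r' then \<eta> / real r' else 0)"
      by (auto simp: pr(4) \<Omega>_def)
    have sums: "(\<Sum>k<r. if k < r' then x else 0) = real r' * x" for x :: real
    proof -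
      have "{..<r} \<inter> {k. k < r'} = {..<r'}" using r' by auto
      then show ?thesis by (simp add: sum.If_cases)
    qed
    have "real r' * M \<le> 576 * (real r / \<eta>) * Q powr (1 / real r) * (1 + ln Q)"
    proof -
      have Qr: "Q powr (1 / real r) \<ge> 1" using Q by (simp add: ge_one_powr_ge_zero)
      \<comment> \<open>Truncation happens only with \<open>r' = t \<ge> ln Q\<close>, and then the
        root is at most \<open>exp 1\<close>.\<close>
      have "Q powr (1 / real r') \<le> 3 * Q powr (1 / real r)"
      proof (cases "r' = r")
        case True
        then show ?thesis by simp
      next
        case False
        then have "r' = t" by (auto simp: r'_def min_def split: if_splits)
        then have "ln Q / real r' \<le> 1" using t r' by simp
        then have "exp (ln Q / real r') \<le> exp 1" by simp
        also have "exp 1 \<le> (3::real)" by (rule exp_le)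
        finally have "Q powr (1 / real r') \<le> 3" using Q by (simp add: powr_def)
        then show ?thesis using Qr by linarith
      qed
      then have d1: "1 / \<delta> \<le> 6 * Q powr (1 / real r)" using d(4) by linarith
      \<comment> \<open>The constant 1 in the potential adds up to \<open>r'\<close> over the
        rounds; truncation at about \<open>ln Q\<close> is what absorbs it into
        \<open>1 + ln Q\<close>.\<close>
      have "real r' * (1 + ln (1 / \<delta>)) = real r' + ln 2 + ln Q"
        unfolding d(5) using r' by (simp add: field_simps)
      also have "\<dots> \<le> 3 * (1 + ln Q)"
      proof -
        have "real r' \<le> real t" by (simp add: r'_def)
        then show ?thesis using t(2) ln_le_minus_one[of "2::real"] lnQ by simp
      qed
      finally have d2: "real r' * (1 + ln (1 / \<delta>)) \<le> 3 * (1 + ln Q)" .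
      have "real r' * M = 32 * (real r' / \<eta>) * (1 / \<delta>) * (real r' * (1 + ln (1 / \<delta>)))"
        using r' eta d(1) by (simp add: M_def field_simps)
      \<comment> \<open>576 is \<open>32 * 6 * 3\<close>.\<close>
      also have "\<dots> \<le> 32 * (real r / \<eta>) * (6 * Q powr (1 / real r)) * (3 * (1 + ln Q))"
      proof (rule mult_mono[OF _ d2])
        show "32 * (real r' / \<eta>) * (1 / \<delta>) \<le> 32 * (real r / \<eta>) * (6 * Q powr (1 / real r))"
          using r' eta d(1) by (intro mult_mono[OF _ d1] mult_left_mono divide_right_mono) auto
        show "0 \<le> real r' * (1 + ln (1 / \<delta>))" using d(1,2) by simp
      qed (use eta in simp)
      also have "\<dots> = 576 * (real r / \<eta>) * Q powr (1 / real r) * (1 + ln Q)"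
      proof -
        have "32 * a * (6 * q) * (3 * b) = 576 * a * q * b" for a q b :: real by simp
        then show ?thesis .
      qed
      finally show ?thesis .
    qed
    then have "(\<Sum>k<r. if k < r' then M else 0) * OPT m c U f D
        \<le> 576 * (real r / \<eta>) * Q powr (1 / real r) * (1 + ln Q) * OPT m c U f D"
      unfolding sums by (rule mult_right_mono) (rule OPT0)
    then show ?thesis using s sums[of "\<eta> / real r'"] r' unfolding D_def Q_def
      by (intro exI[of _ \<sigma>]) auto
  qed
qed

text \<open>The bound carries \<open>real r * (1 + ln (real (f U)))\<close>, so the constants of
  \<open>r\<close> potentials are absorbed and all \<open>r\<close> rounds can be used.\<close>

lemma scenario_cover:
  fixes U :: "'a set" and W :: "'b pmf" and Sc :: "'b \<Rightarrow> nat \<Rightarrow> 'a"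
  assumes W: "finite (set_pmf W)" "card (set_pmf W) = s"
    and inst: "cover_instance U f m c (map_pmf Sc W)" and r: "r \<ge> 1" and eta: "\<eta> > 0"
  shows "\<exists>\<sigma>. set_based_policy m \<sigma> \<and>
    measure_pmf.expectation (map_pmf Sc W) (rounds_cost c r \<sigma>)
      \<le> 576 * (real r / \<eta>) * real s powr (1 / real r) * ((1 + ln (real s)) + real r * (1 + ln (real (f U))))
          * OPT m c U f (map_pmf Sc W) \<and>
    rounds_cover_prob U f r \<sigma> (map_pmf Sc W) \<ge> 1 - \<eta>"
proof -
  define D where "D = map_pmf Sc W"
  define \<Omega> where "\<Omega> = set_pmf D"
  have inst': "cover_instance U f m c D" using inst by (simp add: D_def)
  have ms: "monotone_submodular U f" and c: "\<And>i. i < m \<Longrightarrow> c i > 0"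
    and range: "\<And>\<omega> i. \<omega> \<in> \<Omega> \<Longrightarrow> i < m \<Longrightarrow> \<omega> i \<in> U"
    using inst' by (auto simp: cover_instance_def \<Omega>_def)
  have fin: "finite \<Omega>" using W by (simp add: \<Omega>_def D_def)
  \<comment> \<open>An inequality, because different scenarios may induce the same
    realization.\<close>
  have card: "card \<Omega> \<le> s" using W card_image_le[of "set_pmf W" Sc] by (simp add: \<Omega>_def D_def)
  have s: "s \<ge> 1" using W set_pmf_not_empty[of W] by (metis One_nat_def Suc_leI card_gt_0_iff)
  obtain probes where pr: "decision_path probes" "\<And>\<omega>. probes \<omega> \<subseteq> {..<m}"
    "\<And>\<omega>. \<omega> \<in> \<Omega> \<Longrightarrow> f (\<omega> ` probes \<omega>) = f U" "OPT m c U f D = (\<Sum>\<omega>\<in>\<Omega>. pmf D \<omega> * sum c (probes \<omega>))"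
    using OPT_attained[OF fin[unfolded \<Omega>_def] inst'] unfolding \<Omega>_def by blast
  have cp: "c i \<ge> 0" if "i \<in> probes \<omega>" for i \<omega> using that pr(2)[of \<omega>] c[of i] by force
  have OPT0: "OPT m c U f D \<ge> 0" unfolding pr(4)
    using cp by (intro sum_nonneg mult_nonneg_nonneg pmf_nonneg)
  define \<delta> where "\<delta> = (2 * real s) powr (- 1 / real r)"
  have s': "real s \<ge> 1" using s by simp
  note d = root_scale[OF s' r \<delta>_def]
  have lnU: "ln (real (f U)) \<ge> 0" by (cases "f U") auto
  define M where "M = 16 * (1 + log 2 (1 / \<delta>) + ln (real (f U))) / (\<delta> * (\<eta> / real r))"
  have M: "M \<ge> 0" using d(1,2) eta r lnU by (simp add: M_def)
  define cl where "cl = (\<lambda>A (\<omega> :: nat \<Rightarrow> 'a). {\<omega>'\<in>\<Omega>. \<forall>i\<in>A. \<omega>' i = \<omega> i})"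
  define G where "G = (\<lambda>k A \<omega>. real (card (cl A \<omega>)) \<le> \<delta> ^ k * real s \<or> f (\<omega> ` A) = f U)"
  have Gcong: "G k A \<omega>'" if "G k A \<omega>" "observe \<omega> A = observe \<omega>' A" for k A \<omega> \<omega>'
  proof -
    have "\<omega> ` A = \<omega>' ` A" "cl A \<omega> = cl A \<omega>'"
      using that(2) by (auto simp: observe_eq_iff cl_def intro!: image_cong)
    then show ?thesis using that(1) by (simp add: G_def)
  qed
  have "\<exists>\<sigma>. set_based_policy m \<sigma> \<and>
    measure_pmf.expectation D (rounds_cost c r \<sigma>)
      \<le> (\<Sum>k<r. M) * (\<Sum>\<omega>\<in>set_pmf D. pmf D \<omega> * sum c (probes \<omega>)) \<and>
    rounds_cover_prob U f r \<sigma> D \<ge> 1 - (\<Sum>k<r. \<eta> / real r)"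
  proof (rule policy_from_rounds[where G=G])
    show "finite (set_pmf D)" using fin by (simp add: \<Omega>_def)
    show "G 0 {} \<omega>" for \<omega> using card by (simp add: G_def cl_def)
    show "f (\<omega> ` A) = f U" if "\<omega> \<in> set_pmf D" "A \<subseteq> {..<m}" "G r A \<omega>" for A \<omega>
    proof -
      have "\<omega> \<in> cl A \<omega>" "finite (cl A \<omega>)" using that fin by (auto simp: cl_def \<Omega>_def)
      \<comment> \<open>A class contains its own realization, so its size cannot have dropped to
        \<open>1 / 2\<close>; the schedule must have been met by covering.\<close>
      then have "card (cl A \<omega>) \<ge> 1" by (metis One_nat_def Suc_leI card_gt_0_iff empty_iff)
      then have "\<not> real (card (cl A \<omega>)) \<le> 1 / 2" by linarith
      then show ?thesis using that(3) d(3) by (simp add: G_def)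
    qed
  next
    fix k ob assume k: "k < r" and ob: "dom ob \<subseteq> {..<m}" "cyl (set_pmf D) ob \<noteq> {}"
      and Gk: "\<forall>\<omega>\<in>cyl (set_pmf D) ob. G k (dom ob) \<omega>"
    let ?C = "cyl (set_pmf D) ob"
    have CO: "?C \<subseteq> \<Omega>" by (auto simp: cyl_def \<Omega>_def)
    have finC: "finite ?C" using fin CO by (rule finite_subset[rotated])
    have Ccl: "?C = cl (dom ob) \<omega>" if "\<omega> \<in> ?C" for \<omega>
    proof -
      have "observe \<omega>' (dom ob) = ob \<longleftrightarrow> (\<forall>i\<in>dom ob. \<omega>' i = \<omega> i)" for \<omega>'
        using observe_eq_iff[of \<omega>' "dom ob" \<omega>] that by (simp add: cyl_def)
      then show ?thesis by (simp add: cyl_def cl_def \<Omega>_def)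
    qed
    have W0: "0 < sum (pmf D) ?C"
      using finC ob(2) CO by (intro sum_pos) (auto simp: \<Omega>_def pmf_positive)
    show "\<exists>B. dom ob \<subseteq> B \<and> B \<subseteq> {..<m} \<and>
      sum c (B - dom ob) * sum (pmf D) ?C \<le> M * (\<Sum>\<omega>\<in>?C. pmf D \<omega> * sum c (probes \<omega>)) \<and>
      sum (pmf D) {\<omega>\<in>?C. \<not> G (Suc k) B \<omega>} \<le> \<eta> / real r * sum (pmf D) ?C"
    proof (cases "\<exists>\<omega>\<in>?C. f (\<omega> ` dom ob) = f U")
      \<comment> \<open>Members of the cylinder agree on \<open>dom ob\<close>, so all of them are
        covered and an empty round suffices. Otherwise none is, and \<open>G k\<close> holds through
        its size bound.\<close>
      case True
      then obtain \<omega>0 where o: "\<omega>0 \<in> ?C" "f (\<omega>0 ` dom ob) = f U" by blast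
      have "G (Suc k) (dom ob) \<omega>" if "\<omega> \<in> ?C" for \<omega>
        by (rule Gcong[of _ _ \<omega>0]) (use o that in \<open>auto simp: G_def cyl_def\<close>)
      then have "{\<omega>\<in>?C. \<not> G (Suc k) (dom ob) \<omega>} = {}" by blast
      moreover have "0 \<le> M * (\<Sum>\<omega>\<in>?C. pmf D \<omega> * sum c (probes \<omega>))"
        using M cp by (intro mult_nonneg_nonneg sum_nonneg pmf_nonneg)
      ultimately show ?thesis using ob(1) eta r W0
        by (intro exI[of _ "dom ob"]) (simp del: Collect_empty_eq)
    next
      case False
      obtain \<omega>0 where o: "\<omega>0 \<in> ?C" using ob(2) by blast
      have card_C: "real (card ?C) \<le> \<delta> ^ k * real s"
        using Gk False o Ccl[OF o] by (auto simp: G_def)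
      have "\<exists>B. dom ob \<subseteq> B \<and> B \<subseteq> {..<m} \<and>
        sum c (B - dom ob) * sum (pmf D) ?C
          \<le> 16 * (1 + log 2 (1 / \<delta>) + ln (real (f U))) / (\<delta> * (\<eta> / real r)) * (\<Sum>\<omega>\<in>?C. pmf D \<omega> * sum c (probes \<omega>)) \<and>
        sum (pmf D) {\<omega>\<in>?C. \<not> (real (card {\<omega>'\<in>?C. \<forall>i\<in>B. \<omega>' i = \<omega> i}) \<le> \<delta> * (\<delta> ^ k * real s) \<or> f (\<omega> ` B) = f U)}
          \<le> \<eta> / real r * sum (pmf D) ?C"
        by (rule scenario_round[OF ms finC finite_lessThan])
          (use c pr CO range ob(1) d(1,2) s eta r W0 card_C in auto)
      then obtain B where B: "dom ob \<subseteq> B" "B \<subseteq> {..<m}"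
        "sum c (B - dom ob) * sum (pmf D) ?C \<le> M * (\<Sum>\<omega>\<in>?C. pmf D \<omega> * sum c (probes \<omega>))"
        "sum (pmf D) {\<omega>\<in>?C. \<not> (real (card {\<omega>'\<in>?C. \<forall>i\<in>B. \<omega>' i = \<omega> i}) \<le> \<delta> * (\<delta> ^ k * real s) \<or> f (\<omega> ` B) = f U)}
          \<le> \<eta> / real r * sum (pmf D) ?C"
        unfolding M_def by blast
      \<comment> \<open>Since \<open>B\<close> contains \<open>dom ob\<close>, agreement on
        \<open>B\<close> already implies membership in the cylinder.\<close>
      have "{\<omega>'\<in>?C. \<forall>i\<in>B. \<omega>' i = \<omega> i} = cl B \<omega>" if "\<omega> \<in> ?C" for \<omega>
        unfolding Ccl[OF that] using B(1) by (auto simp: cl_def)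
      then have "{\<omega>\<in>?C. \<not> (real (card {\<omega>'\<in>?C. \<forall>i\<in>B. \<omega>' i = \<omega> i}) \<le> \<delta> * (\<delta> ^ k * real s) \<or> f (\<omega> ` B) = f U)}
          = {\<omega>\<in>?C. \<not> G (Suc k) B \<omega>}"
        by (intro Collect_cong) (auto simp: G_def mult.assoc)
      then show ?thesis using B by auto
    qed
  qed (use c pr M eta Gcong in auto)
  then obtain \<sigma> where sg: "set_based_policy m \<sigma>"
    "measure_pmf.expectation D (rounds_cost c r \<sigma>) \<le> real r * M * OPT m c U f D"
    "rounds_cover_prob U f r \<sigma> D \<ge> 1 - \<eta>"
    using r by (auto simp: pr(4) \<Omega>_def)
  have "real r * M \<le> 576 * (real r / \<eta>) * real s powr (1 / real r) * ((1 + ln (real s)) + real r * (1 + ln (real (f U))))"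
  proof -
    let ?b = "(1 + ln (real s)) + real r * (1 + ln (real (f U)))"
    have lns: "ln (real s) \<ge> 0" using s by simp
    have "log 2 (1 / \<delta>) = (1 + log 2 (real s)) / real r"
      unfolding log_def d(5) using s by (simp add: field_simps)
    then have "real r * (1 + log 2 (1 / \<delta>) + ln (real (f U))) = real r + 1 + log 2 (real s) + real r * ln (real (f U))"
      using r by (simp add: field_simps)
    also have "\<dots> \<le> 2 * ?b"
    proof -
      \<comment> \<open>Passing from base 2 to the natural logarithm costs at most a factor 2, as
        \<open>2 * ln 2 \<ge> 1\<close>.\<close>
      have "ln (real s) * 1 \<le> ln (real s) * (2 * ln 2)"
        using ln2_ge_two_thirds lns by (intro mult_left_mono) auto
      then have "log 2 (real s) \<le> 2 * ln (real s)" by (simp add: log_def field_simps)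
      moreover have "real r * ln (real (f U)) \<ge> 0" using lnU by simp
      ultimately show ?thesis using r by (simp add: algebra_simps)
    qed
    finally have d2: "real r * (1 + log 2 (1 / \<delta>) + ln (real (f U))) \<le> 2 * ?b" .
    have b0: "?b \<ge> 0" using lns lnU by simp
    have "real r * M = 16 * (real r / \<eta>) * (1 / \<delta>) * (real r * (1 + log 2 (1 / \<delta>) + ln (real (f U))))"
      using r eta d(1) by (simp add: M_def field_simps)
    also have "\<dots> \<le> 16 * (real r / \<eta>) * (2 * real s powr (1 / real r)) * (2 * ?b)"
    proof (rule mult_mono[OF _ d2])
      show "16 * (real r / \<eta>) * (1 / \<delta>) \<le> 16 * (real r / \<eta>) * (2 * real s powr (1 / real r))"
        using eta by (intro mult_left_mono[OF d(4)]) simp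
      show "0 \<le> real r * (1 + log 2 (1 / \<delta>) + ln (real (f U)))" using d(1,2) lnU by simp
    qed (use eta in simp)
    also have "\<dots> = 64 * ((real r / \<eta>) * real s powr (1 / real r) * ?b)" by (simp only: mult_ac) simp
    also have "\<dots> \<le> 576 * ((real r / \<eta>) * real s powr (1 / real r) * ?b)"
      using b0 eta by (intro mult_right_mono mult_nonneg_nonneg) auto
    finally show ?thesis by (simp only: mult.assoc)
  qed
  then have "real r * M * OPT m c U f D
      \<le> 576 * (real r / \<eta>) * real s powr (1 / real r) * ((1 + ln (real s)) + real r * (1 + ln (real (f U)))) * OPT m c U f D"
    by (rule mult_right_mono) (rule OPT0)
  then show ?thesis using sg unfolding D_def by (intro exI[of _ \<sigma>]) auto
qed

theorem mainTheorem7: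
  "\<exists>C::real. C > 0 \<and>
    (\<forall>(U::nat set) f m c (P::nat \<Rightarrow> nat pmf) (r::nat) (\<eta>::real).
       cover_instance U f m c (Pi_pmf {..<m} undefined P) \<longrightarrow> r \<ge> 1 \<longrightarrow> \<eta> > 0 \<longrightarrow>
       (\<exists>\<sigma>. set_based_policy m \<sigma> \<and>
          measure_pmf.expectation (Pi_pmf {..<m} undefined P) (rounds_cost c r \<sigma>)
            \<le> C * (real r / \<eta>) * real (f U) powr (1 / real r) * (1 + ln (real (f U)))
                * OPT m c U f (Pi_pmf {..<m} undefined P) \<and>
          rounds_cover_prob U f r \<sigma> (Pi_pmf {..<m} undefined P) \<ge> 1 - \<eta>)) \<and>
    (\<forall>(U::nat set) f m c (W::nat pmf) (s::nat) (Sc::nat \<Rightarrow> nat \<Rightarrow> nat) (r::nat) (\<eta>::real).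
       set_pmf W = {..<s} \<longrightarrow>
       cover_instance U f m c (map_pmf Sc W) \<longrightarrow> r \<ge> 1 \<longrightarrow> \<eta> > 0 \<longrightarrow>
       (\<exists>\<sigma>. set_based_policy m \<sigma> \<and>
          measure_pmf.expectation (map_pmf Sc W) (rounds_cost c r \<sigma>)
            \<le> C * (real r / \<eta>) * real s powr (1 / real r)
                * ((1 + ln (real s)) + real r * (1 + ln (real (f U))))
                * OPT m c U f (map_pmf Sc W) \<and>
          rounds_cover_prob U f r \<sigma> (map_pmf Sc W) \<ge> 1 - \<eta>))"
proof (rule exI[of _ 576], intro conjI allI impI)
  show "(0::real) < 576" by simp
qed (rule stochastic_cover scenario_cover; simp)+

end
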